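(* Let $(M,F)$ be an $n$-dimensional Finsler manifold, let $\Gamma$ be the vertical Liouville vector field on $TM^0$, and let $\mathcal{L}_\Gamma'$ be the $G$-orthogonal complement of $\mathcal{L}_\Gamma=\mathrm{span}\{\Gamma\}$ in the vertical bundle $V(TM^0)$. A connection $\nabla^1$ on the vector bundle $\mathcal{L}_\Gamma'$ is basic with respect to the subfoliation $(\mathcal{F}_V,\mathcal{F}_\Gamma)$ if and only if $$\nabla^1_\Gamma Z=[\Gamma,Z]\qquad\text{for all } Z\in\Gamma(\mathcal{L}_\Gamma').$$
   Context: $(M,F)$ is a Finsler manifold of dimension $n$; $TM^0=TM\setminus\{\text{zero section}\}$, with induced local coordinates $(x^i,y^i)$, $i=1,\dots,n$, and summation over repeated indices. For a vector bundle $E$, $\Gamma(E)$ denotes its sections. Put $g_{ij}=\frac12\frac{\partial^2F^2}{\partial y^i\partial y^j}$, with inverse $(g^{ij})$. The vertical bundle $V(TM^0)$, locally spanned by $\{\partial/\partial y^i\}$, is tangent to the vertical foliation $\mathcal{F}_V$ (the fibers of $TM^0\to M$). Put $G^i=\frac14g^{ik}\left(\frac{\partial^2F^2}{\partial y^k\partial x^h}y^h-\frac{\partial F^2}{\partial x^k}\right)$, $G_i^j=\frac{\partial G^j}{\partial y^i}$, $\frac{\delta}{\delta x^i}=\frac{\partial}{\partial x^i}-G_i^j\frac{\partial}{\partial y^j}$; these span the horizontal distribution $H(TM^0)$, and $T(TM^0)=H(TM^0)\oplus V(TM^0)$. The Riemannian metric $G$ on $TM^0$ is the Sasaki lift: $G(\frac{\delta}{\delta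 x^i},\frac{\delta}{\delta x^j})=G(\frac{\partial}{\partial y^i},\frac{\partial}{\partial y^j})=g_{ij}$, $G(\frac{\delta}{\delta x^i},\frac{\partial}{\partial y^j})=0$. The vertical Liouville vector field is $\Gamma=y^i\frac{\partial}{\partial y^i}$; $\mathcal{L}_\Gamma$ is the line distribution spanned by $\Gamma$, with foliation $\mathcal{F}_\Gamma$; $\mathcal{L}_\Gamma'=\{X\in V(TM^0): G(X,\Gamma)=0\}$, so $V(TM^0)=\mathcal{L}_\Gamma'\oplus\mathcal{L}_\Gamma$, and $\pi_0:V(TM^0)\to\mathcal{L}_\Gamma'$ is the corresponding projection (identifying $V(TM^0)/\mathcal{L}_\Gamma\cong\mathcal{L}_\Gamma'$). Definition. A connection $\nabla^1$ on $\mathcal{L}_\Gamma'$ is basic with respect to $(\mathcal{F}_V,\mathcal{F}_\Gamma)$ if $\nabla^1_XZ=\pi_0[X,\widetilde Z]$ for all $X\in\Gamma(\mathcal{L}_\Gamma)$, $Z\in\Gamma(\mathcal{L}_\Gamma')$ and all $\widetilde Z\in\Gamma(V(TM^0))$ with $\pi_0(\widetilde Z)=Z$. *)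

theory Defs
  imports "HOL-Analysis.Analysis"
begin

section \<open>Smooth maps\<close>

text \<open>On an open subset of a Euclidean space, all iterated directional derivatives of order up to
  \<open>k\<close> exist and are continuous.  Used for open sets only.\<close>

fun Ck_on :: "nat \<Rightarrow> 'a::euclidean_space set \<Rightarrow> ('a \<Rightarrow> 'b::real_normed_vector) \<Rightarrow> bool" where
  "Ck_on 0 S f \<longleftrightarrow> continuous_on S f"
| "Ck_on (Suc k) S f \<longleftrightarrow>
     (\<forall>x\<in>S. f differentiable (at x)) \<and> (\<forall>v. Ck_on k S (\<lambda>x. frechet_derivative f (at x) v))"

definition smooth_on :: "'a::euclidean_space set \<Rightarrow> ('a \<Rightarrow> 'b::real_normed_vector) \<Rightarrow> bool" where
  "smooth_on S f \<longleftrightarrow> (\<forall>k. Ck_on k S f)"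


section \<open>Smooth manifolds, tangent vectors and vector fields\<close>

text \<open>A chart is a pair of its domain and its coordinate map; the values of the coordinate map
  outside the domain are irrelevant.\<close>

type_synonym ('p, 'e) chart = "'p set \<times> ('p \<Rightarrow> 'e)"

text \<open>A tangent vector is given by its components in all charts of the atlas.\<close>

type_synonym ('p, 'e) tvec = "('p, 'e) chart \<Rightarrow> 'e"

type_synonym ('p, 'e) vfield = "'p \<Rightarrow> ('p, 'e) tvec"

definition chart_inv :: "('p, 'e) chart \<Rightarrow> 'e \<Rightarrow> 'p" where
  "chart_inv c = inv_into (fst c) (snd c)"

definition transition :: "('p, 'e) chart \<Rightarrow> ('p, 'e) chart \<Rightarrow> 'e \<Rightarrow> 'e" where
  "transition c d = snd d \<circ> chart_inv c"

definition carrier_of :: "('p, 'e) chart set \<Rightarrow> 'p set" where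
  "carrier_of A = (\<Union>c\<in>A. fst c)"

definition smooth_manifold :: "'p topology \<Rightarrow> ('p, 'e::euclidean_space) chart set \<Rightarrow> bool" where
  "smooth_manifold T A \<longleftrightarrow>
     Hausdorff_space T \<and> second_countable T \<and> topspace T = carrier_of A \<and>
     (\<forall>c\<in>A. openin T (fst c) \<and> open (snd c ` fst c) \<and>
        homeomorphic_map (subtopology T (fst c)) (top_of_set (snd c ` fst c)) (snd c)) \<and>
     (\<forall>c\<in>A. \<forall>d\<in>A. smooth_on (snd c ` (fst c \<inter> fst d)) (transition c d))"

text \<open>The components transform by the Jacobian of the change of coordinates.  The components in
  charts not containing the base point are set to zero, so that equality of tangent vectors is
  equality of functions; the zero vector is the constant function with value zero.\<close>

definition tangent_space :: "('p, 'e::euclidean_space) chart set \<Rightarrow> 'p \<Rightarrow> ('p, 'e) tvec set" where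
  "tangent_space A p =
     {\<xi>. (\<forall>c. \<not> (c \<in> A \<and> p \<in> fst c) \<longrightarrow> \<xi> c = 0) \<and>
         (\<forall>c\<in>A. \<forall>d\<in>A. p \<in> fst c \<longrightarrow> p \<in> fst d \<longrightarrow>
            \<xi> d = frechet_derivative (transition c d) (at (snd c p)) (\<xi> c))}"

text \<open>Functions and vector fields are only relevant on the manifold; vector fields are
  extended by zero to the ambient type.\<close>

definition smooth_functions :: "('p, 'e::euclidean_space) chart set \<Rightarrow> ('p \<Rightarrow> real) set" where
  "smooth_functions A = {f. \<forall>c\<in>A. smooth_on (snd c ` fst c) (f \<circ> chart_inv c)}"

definition vector_fields :: "('p, 'e::euclidean_space) chart set \<Rightarrow> ('p, 'e) vfield set" where
  "vector_fields A =
     {X. (\<forall>p\<in>carrier_of A. X p \<in> tangent_space A p) \<and>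
         (\<forall>p. p \<notin> carrier_of A \<longrightarrow> X p = (\<lambda>_. 0)) \<and>
         (\<forall>c\<in>A. smooth_on (snd c ` fst c) (\<lambda>u. X (chart_inv c u) c))}"

definition vf_add :: "('p, 'e::euclidean_space) vfield \<Rightarrow> ('p, 'e) vfield \<Rightarrow> ('p, 'e) vfield" where
  "vf_add X Y = (\<lambda>p c. X p c + Y p c)"

definition vf_scale :: "('p \<Rightarrow> real) \<Rightarrow> ('p, 'e::euclidean_space) vfield \<Rightarrow> ('p, 'e) vfield" where
  "vf_scale f X = (\<lambda>p c. f p *\<^sub>R X p c)"

text \<open>Only used for coordinate expressions whose value does not depend on the chart.\<close>

definition chart_at :: "('p, 'e) chart set \<Rightarrow> 'p \<Rightarrow> ('p, 'e) chart" where
  "chart_at A p = (SOME c. c \<in> A \<and> p \<in> fst c)"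

definition vf_apply ::
    "('p, 'e::euclidean_space) chart set \<Rightarrow> ('p, 'e) vfield \<Rightarrow> ('p \<Rightarrow> real) \<Rightarrow> 'p \<Rightarrow> real" where
  "vf_apply A X f p =
     (let c = chart_at A p in frechet_derivative (f \<circ> chart_inv c) (at (snd c p)) (X p c))"

text \<open>In coordinates, \<open>[X,Y]\<^sup>i = X\<^sup>j \<partial>\<^sub>j Y\<^sup>i - Y\<^sup>j \<partial>\<^sub>j X\<^sup>i\<close>.\<close>

definition lie_bracket ::
    "('p, 'e::euclidean_space) chart set \<Rightarrow> ('p, 'e) vfield \<Rightarrow> ('p, 'e) vfield \<Rightarrow> ('p, 'e) vfield" where
  "lie_bracket A X Y = (\<lambda>p c.
     if c \<in> A \<and> p \<in> fst c
     then frechet_derivative (\<lambda>u. Y (chart_inv c u) c) (at (snd c p)) (X p c)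
        - frechet_derivative (\<lambda>u. X (chart_inv c u) c) (at (snd c p)) (Y p c)
     else 0)"

text \<open>Sections of a subbundle \<open>D\<close> of the tangent bundle, and connections on \<open>D\<close>
  as a vector bundle over the whole manifold.\<close>

definition sections ::
    "('p, 'e::euclidean_space) chart set \<Rightarrow> ('p \<Rightarrow> ('p, 'e) tvec set) \<Rightarrow> ('p, 'e) vfield set" where
  "sections A D = {X \<in> vector_fields A. \<forall>p\<in>carrier_of A. X p \<in> D p}"

definition bundle_connection ::
    "('p, 'e::euclidean_space) chart set \<Rightarrow> ('p \<Rightarrow> ('p, 'e) tvec set)
      \<Rightarrow> (('p, 'e) vfield \<Rightarrow> ('p, 'e) vfield \<Rightarrow> ('p, 'e) vfield) \<Rightarrow> bool" where
  "bundle_connection A D nabla \<longleftrightarrow>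
     (\<forall>X\<in>vector_fields A. \<forall>Z\<in>sections A D. nabla X Z \<in> sections A D) \<and>
     (\<forall>X\<in>vector_fields A. \<forall>Y\<in>vector_fields A. \<forall>Z\<in>sections A D.
        nabla (vf_add X Y) Z = vf_add (nabla X Z) (nabla Y Z)) \<and>
     (\<forall>f\<in>smooth_functions A. \<forall>X\<in>vector_fields A. \<forall>Z\<in>sections A D.
        nabla (vf_scale f X) Z = vf_scale f (nabla X Z)) \<and>
     (\<forall>X\<in>vector_fields A. \<forall>Z\<in>sections A D. \<forall>W\<in>sections A D.
        nabla X (vf_add Z W) = vf_add (nabla X Z) (nabla X W)) \<and>
     (\<forall>f\<in>smooth_functions A. \<forall>X\<in>vector_fields A. \<forall>Z\<in>sections A D.
        nabla X (vf_scale f Z) = vf_add (vf_scale (vf_apply A X f) Z) (vf_scale f (nabla X Z)))"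


section \<open>The slit tangent bundle\<close>

type_synonym ('m, 'e) tpoint = "'m \<times> ('m, 'e) tvec"

definition tangent_bundle :: "('m, 'e::euclidean_space) chart set \<Rightarrow> ('m, 'e) tpoint set" where
  "tangent_bundle A = Sigma (carrier_of A) (tangent_space A)"

definition slit_tangent_bundle :: "('m, 'e::euclidean_space) chart set \<Rightarrow> ('m, 'e) tpoint set" where
  "slit_tangent_bundle A = {v \<in> tangent_bundle A. snd v \<noteq> (\<lambda>_. 0)}"

text \<open>The induced coordinates \<open>(x, y)\<close> on the slit tangent bundle.\<close>

definition induced_chart ::
    "('m, 'e::euclidean_space) chart set \<Rightarrow> ('m, 'e) chart \<Rightarrow> (('m, 'e) tpoint, 'e \<times> 'e) chart" where
  "induced_chart A c =
     ({v \<in> slit_tangent_bundle A. fst v \<in> fst c}, \<lambda>v. (snd c (fst v), snd v c))"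

definition slit_atlas ::
    "('m, 'e::euclidean_space) chart set \<Rightarrow> (('m, 'e) tpoint, 'e \<times> 'e) chart set" where
  "slit_atlas A = induced_chart A ` A"

text \<open>The span of the \<open>\<partial>/\<partial>y\<^sup>i\<close>: in induced coordinates, the components along the
  \<open>\<partial>/\<partial>x\<^sup>i\<close> vanish.\<close>

definition vertical ::
    "('m, 'e::euclidean_space) chart set \<Rightarrow> ('m, 'e) tpoint
      \<Rightarrow> (('m, 'e) tpoint, 'e \<times> 'e) tvec set" where
  "vertical A v =
     {w \<in> tangent_space (slit_atlas A) v. \<forall>d\<in>slit_atlas A. v \<in> fst d \<longrightarrow> fst (w d) = 0}"

text \<open>The vertical Liouville field \<open>y\<^sup>i \<partial>/\<partial>y\<^sup>i\<close>; here \<open>snd (snd d v)\<close> is the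
  \<open>y\<close>-coordinate of \<open>v\<close>.\<close>

definition liouville ::
    "('m, 'e::euclidean_space) chart set \<Rightarrow> (('m, 'e) tpoint, 'e \<times> 'e) vfield" where
  "liouville A = (\<lambda>v d. if d \<in> slit_atlas A \<and> v \<in> fst d then (0, snd (snd d v)) else 0)"

definition liouville_line ::
    "('m, 'e::euclidean_space) chart set \<Rightarrow> ('m, 'e) tpoint
      \<Rightarrow> (('m, 'e) tpoint, 'e \<times> 'e) tvec set" where
  "liouville_line A v = {\<lambda>d. t *\<^sub>R liouville A v d | t. True}"


section \<open>Finsler manifolds and the Sasaki lift\<close>

text \<open>Coordinate expressions at the point with induced coordinates \<open>u = (x, y)\<close>; the
  function \<open>L\<close> stands for the coordinate expression of \<open>F\<^sup>2\<close>.\<close>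

type_synonym 'n xy = "(real ^ 'n) \<times> (real ^ 'n)"

definition dx :: "'n \<Rightarrow> ('n xy \<Rightarrow> real) \<Rightarrow> ('n::finite) xy \<Rightarrow> real" where
  "dx i f u = frechet_derivative f (at u) (axis i 1, 0)"

definition dy :: "'n \<Rightarrow> ('n xy \<Rightarrow> real) \<Rightarrow> ('n::finite) xy \<Rightarrow> real" where
  "dy i f u = frechet_derivative f (at u) (0, axis i 1)"

definition fund_matrix ::
    "('n xy \<Rightarrow> real) \<Rightarrow> ('n::finite) xy \<Rightarrow> real ^ 'n ^ 'n" where
  "fund_matrix L u = (\<chi> i j. 1 / 2 * dy i (dy j L) u)"

definition spray_coeff ::
    "('n xy \<Rightarrow> real) \<Rightarrow> 'n \<Rightarrow> ('n::finite) xy \<Rightarrow> real" where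
  "spray_coeff L i u =
     1 / 4 * (\<Sum>k\<in>UNIV. matrix_inv (fund_matrix L u) $ i $ k
                * ((\<Sum>h\<in>UNIV. dy k (dx h L) u * snd u $ h) - dx k L u))"

text \<open>Row \<open>i\<close>, column \<open>j\<close> is \<open>G\<^sub>i\<^sup>j = \<partial>G\<^sup>j/\<partial>y\<^sup>i\<close>.\<close>

definition nonlinear_coeff ::
    "('n xy \<Rightarrow> real) \<Rightarrow> ('n::finite) xy \<Rightarrow> real ^ 'n ^ 'n" where
  "nonlinear_coeff L u = (\<chi> i j. dy i (spray_coeff L j) u)"

text \<open>The frame \<open>\<delta>/\<delta>x\<^sup>i = \<partial>/\<partial>x\<^sup>i - G\<^sub>i\<^sup>j \<partial>/\<partial>y\<^sup>j\<close>, \<open>\<partial>/\<partial>y\<^sup>i\<close>.\<close>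

definition delta_x ::
    "('n xy \<Rightarrow> real) \<Rightarrow> ('n::finite) xy \<Rightarrow> 'n \<Rightarrow> 'n xy" where
  "delta_x L u i = (axis i 1, - (nonlinear_coeff L u $ i))"

definition partial_y :: "'n::finite \<Rightarrow> 'n xy" where
  "partial_y i = (0, axis i 1)"

text \<open>Since \<open>a\<^sup>i \<partial>/\<partial>x\<^sup>i + b\<^sup>j \<partial>/\<partial>y\<^sup>j = a\<^sup>i \<delta>/\<delta>x\<^sup>i + (b\<^sup>j + a\<^sup>i G\<^sub>i\<^sup>j) \<partial>/\<partial>y\<^sup>j\<close>, the
  vertical components of \<open>(a, b)\<close> are \<open>b\<^sup>j + a\<^sup>i G\<^sub>i\<^sup>j\<close>.\<close>

definition vert_part ::
    "('n xy \<Rightarrow> real) \<Rightarrow> ('n::finite) xy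
      \<Rightarrow> 'n xy \<Rightarrow> real ^ 'n" where
  "vert_part L u w = snd w + fst w v* nonlinear_coeff L u"

definition sasaki_coord ::
    "('n xy \<Rightarrow> real) \<Rightarrow> ('n::finite) xy
      \<Rightarrow> 'n xy \<Rightarrow> 'n xy \<Rightarrow> real" where
  "sasaki_coord L u w w' =
     fst w \<bullet> (fund_matrix L u *v fst w') + vert_part L u w \<bullet> (fund_matrix L u *v vert_part L u w')"

lemma vert_part_frame:
  "vert_part L u (delta_x L u i) = 0" "vert_part L u (partial_y i) = axis i 1"
  by (simp_all add: vert_part_def delta_x_def partial_y_def vec_eq_iff vector_matrix_mult_def
        axis_def if_distrib if_distribR cong: if_cong)

text \<open>The values on the frame determine the bilinear form.\<close>

lemma sasaki_coord_frame:
  "sasaki_coord L u (delta_x L u i) (delta_x L u j) = fund_matrix L u $ i $ j"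
  "sasaki_coord L u (partial_y i) (partial_y j) = fund_matrix L u $ i $ j"
  "sasaki_coord L u (delta_x L u i) (partial_y j) = 0"
  "sasaki_coord L u (partial_y j) (delta_x L u i) = 0"
  unfolding sasaki_coord_def vert_part_frame
  by (simp_all add: delta_x_def partial_y_def inner_axis' matrix_vector_mult_basis column_def)

text \<open>The coordinate expression of \<open>F\<^sup>2\<close> in a chart of the slit tangent bundle.\<close>

definition F_sq ::
    "(('m, real ^ 'n::finite) tpoint \<Rightarrow> real) \<Rightarrow> (('m, real ^ 'n) tpoint, 'n xy) chart
      \<Rightarrow> 'n xy \<Rightarrow> real" where
  "F_sq F d = (\<lambda>u. (F (chart_inv d u))\<^sup>2)"

definition finsler_manifold ::
    "'m topology \<Rightarrow> ('m, real ^ 'n::finite) chart set \<Rightarrow> (('m, real ^ 'n) tpoint \<Rightarrow> real) \<Rightarrow> bool" where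
  "finsler_manifold T A F \<longleftrightarrow>
     smooth_manifold T A \<and>
     (\<forall>v\<in>tangent_bundle A. 0 \<le> F v) \<and>
     (\<forall>v\<in>slit_tangent_bundle A. 0 < F v) \<and>
     F \<in> smooth_functions (slit_atlas A) \<and>
     (\<forall>(p, \<xi>)\<in>tangent_bundle A. \<forall>t>0. F (p, \<lambda>c. t *\<^sub>R \<xi> c) = t * F (p, \<xi>)) \<and>
     (\<forall>d\<in>slit_atlas A. \<forall>v\<in>fst d. \<forall>b. b \<noteq> 0 \<longrightarrow>
        0 < b \<bullet> (fund_matrix (F_sq F d) (snd d v) *v b))"

definition sasaki ::
    "('m, real ^ 'n::finite) chart set \<Rightarrow> (('m, real ^ 'n) tpoint \<Rightarrow> real) \<Rightarrow> ('m, real ^ 'n) tpoint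
      \<Rightarrow> (('m, real ^ 'n) tpoint, 'n xy) tvec
      \<Rightarrow> (('m, real ^ 'n) tpoint, 'n xy) tvec \<Rightarrow> real" where
  "sasaki A F v w w' =
     (let d = chart_at (slit_atlas A) v in sasaki_coord (F_sq F d) (snd d v) (w d) (w' d))"


section \<open>Basic connections\<close>

text \<open>The orthogonal complement of the Liouville line in the vertical bundle, and the projection
  along the decomposition of the vertical bundle into these two subbundles.\<close>

definition liouville_perp ::
    "('m, real ^ 'n::finite) chart set \<Rightarrow> (('m, real ^ 'n) tpoint \<Rightarrow> real) \<Rightarrow> ('m, real ^ 'n) tpoint
      \<Rightarrow> (('m, real ^ 'n) tpoint, 'n xy) tvec set" where
  "liouville_perp A F v = {w \<in> vertical A v. sasaki A F v w (liouville A v) = 0}"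

definition proj_perp ::
    "('m, real ^ 'n::finite) chart set \<Rightarrow> (('m, real ^ 'n) tpoint \<Rightarrow> real)
      \<Rightarrow> (('m, real ^ 'n) tpoint, 'n xy) vfield
      \<Rightarrow> (('m, real ^ 'n) tpoint, 'n xy) vfield" where
  "proj_perp A F W = (\<lambda>v.
     if v \<in> slit_tangent_bundle A
     then (THE z. z \<in> liouville_perp A F v \<and> (\<exists>l\<in>liouville_line A v. W v = (\<lambda>d. z d + l d)))
     else (\<lambda>_. 0))"

definition basic_connection ::
    "('m, real ^ 'n::finite) chart set \<Rightarrow> (('m, real ^ 'n) tpoint \<Rightarrow> real)
      \<Rightarrow> ((('m, real ^ 'n) tpoint, 'n xy) vfield
          \<Rightarrow> (('m, real ^ 'n) tpoint, 'n xy) vfield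
          \<Rightarrow> (('m, real ^ 'n) tpoint, 'n xy) vfield) \<Rightarrow> bool" where
  "basic_connection A F nabla \<longleftrightarrow>
     (\<forall>X \<in> sections (slit_atlas A) (liouville_line A).
      \<forall>Z \<in> sections (slit_atlas A) (liouville_perp A F).
      \<forall>Z' \<in> sections (slit_atlas A) (vertical A).
        proj_perp A F Z' = Z \<longrightarrow> nabla X Z = proj_perp A F (lie_bracket (slit_atlas A) X Z'))"

end

theory Submission
  imports Defs
begin

text \<open>For a section \<open>Z\<close> of the complement of \<open>\<Gamma>\<close>, the bracket \<open>[\<Gamma>, Z]\<close> is again a section of it: it is
  vertical, and \<open>g(Z, \<Gamma>) = 0\<close> can be differentiated along \<open>\<Gamma>\<close> because \<open>g\<close> is homogeneous of degree 0
  in \<open>y\<close>. So the projection in the definition of a basic connection can be dropped for \<open>X = \<Gamma>\<close> and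
  \<open>Z' = Z\<close>. Conversely, \<open>X = f\<Gamma>\<close> and \<open>Z' = Z + h\<Gamma>\<close> with smooth \<open>f\<close> and \<open>h\<close>, and \<open>[X, Z']\<close> differs
  from \<open>f[\<Gamma>, Z]\<close> by a multiple of \<open>\<Gamma>\<close>.\<close>

section \<open>Calculus of smooth maps\<close>

text \<open>A tangent vector is the family of its components in all charts, so the coordinate
  formula for the bracket yields one only after its transformation law is checked. For vertical
  fields this stays elementary: over a fixed base point the change of induced coordinates is one
  fixed linear map of the fibre, and differentiating along the fibre never meets a derivative of
  that map. The Sasaki lift, and with it orthogonality, is evaluated in a chart picked by
  \<open>chart_at\<close>. On the slit bundle that pick depends only on the base point, so a single
  chart serves a whole ray, and the orthogonality relation can be differentiated there. The
  coefficients \<open>f\<close> and \<open>h\<close> are given only pointwise at first. Their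
  smoothness matters because a connection is linear over smooth functions and the bracket
  differentiates both. In coordinates they are quotients with denominator
  \<open>y \<bullet> y\<close>, which is nonzero because the zero section has been removed.\<close>

lemma frechet_derivative_cong_open:
  assumes "open S" "x \<in> S" "\<And>y. y \<in> S \<Longrightarrow> f y = g y" "f differentiable (at x)"
  shows "g differentiable (at x)" "frechet_derivative g (at x) = frechet_derivative f (at x)"
proof -
  have "(f has_derivative frechet_derivative f (at x)) (at x)"
    using assms(4) by (simp add: frechet_derivative_works)
  then have g: "(g has_derivative frechet_derivative f (at x)) (at x)"
    using assms(1-3) by (rule has_derivative_transform_within_open)
  then show "g differentiable (at x)"
    by (auto simp: differentiable_def)
  show "frechet_derivative g (at x) = frechet_derivative f (at x)"
    using frechet_derivative_at[OF g] by simp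
qed

text \<open>Turns derivatives in a vertical direction into derivatives of functions of one real
  variable, so that two charts can be compared along a segment inside a fibre.\<close>

lemma frechet_derivative_along_line:
  assumes "f differentiable (at u)"
  shows "((\<lambda>s. f (u + s *\<^sub>R w)) has_vector_derivative frechet_derivative f (at u) w) (at 0)"
proof -
  have "(f has_derivative frechet_derivative f (at u)) (at (u + 0 *\<^sub>R w))"
    using assms by (simp add: frechet_derivative_works)
  moreover have "((\<lambda>s. u + s *\<^sub>R w) has_derivative (\<lambda>s. s *\<^sub>R w)) (at (0::real))"
    by (auto intro!: derivative_eq_intros)
  ultimately have "((\<lambda>s. f (u + s *\<^sub>R w)) has_derivative
      (\<lambda>s. frechet_derivative f (at u) (s *\<^sub>R w))) (at (0::real))"
    by (rule has_derivative_compose[rotated])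
  then show ?thesis
    by (simp add: has_vector_derivative_def linear_cmul[OF linear_frechet_derivative[OF assms]])
qed

text \<open>The filter \<open>at t\<close> leaves out \<open>t\<close> itself, hence the separate
  hypothesis on the values there.\<close>

lemma has_vector_derivative_unique_eventually:
  assumes "\<forall>\<^sub>F s in at t. f s = g s" "f t = g t"
    and f: "(f has_vector_derivative a) (at t)" and g: "(g has_vector_derivative b) (at t)"
  shows "a = b"
proof -
  have "(g has_vector_derivative a) (at t)"
    using has_derivative_transform_eventually[OF f[unfolded has_vector_derivative_def] assms(1,2)]
    by (simp add: has_vector_derivative_def)
  then show ?thesis
    using g by (rule vector_derivative_unique_at)
qed

lemma Ck_on_Suc_differentiable:
  "Ck_on (Suc k) S f \<Longrightarrow> x \<in> S \<Longrightarrow> f differentiable (at x)"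
  by simp

lemma smooth_on_differentiable:
  "smooth_on S f \<Longrightarrow> x \<in> S \<Longrightarrow> f differentiable (at x)"
  unfolding smooth_on_def using Ck_on_Suc_differentiable by blast

lemma smooth_on_frechet_derivative:
  "smooth_on S f \<Longrightarrow> smooth_on S (\<lambda>x. frechet_derivative f (at x) v)"
  unfolding smooth_on_def using Ck_on.simps(2) by blast

text \<open>Coordinate expressions contain \<open>chart_inv\<close>, whose values off the chart
  image carry no meaning. Openness of \<open>S\<close> keeps those values out of every
  derivative.\<close>

lemma Ck_on_cong:
  assumes "open S" "\<And>x. x \<in> S \<Longrightarrow> f x = g x" "Ck_on k S f"
  shows "Ck_on k S g"
  using assms(2,3)
proof (induction k arbitrary: f g)
  case 0
  then show ?case by (simp cong: continuous_on_cong)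
next
  case (Suc k)
  have "g differentiable (at x)" "frechet_derivative g (at x) = frechet_derivative f (at x)"
    if "x \<in> S" for x
    using frechet_derivative_cong_open[OF assms(1) that, of f g] Suc.prems that by auto
  moreover have "Ck_on k S (\<lambda>x. frechet_derivative g (at x) v)" for v
    by (rule Suc.IH[of "\<lambda>x. frechet_derivative f (at x) v"]) (use calculation Suc.prems in auto)
  ultimately show ?case by simp
qed

lemma smooth_on_cong:
  "open S \<Longrightarrow> (\<And>x. x \<in> S \<Longrightarrow> f x = g x) \<Longrightarrow> smooth_on S f \<Longrightarrow> smooth_on S g"
  unfolding smooth_on_def using Ck_on_cong by blast

lemma Ck_on_SucD: "Ck_on (Suc k) S f \<Longrightarrow> Ck_on k S f"
proof (induction k arbitrary: f)
  case 0
  then show ?case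
    by (auto intro!: continuous_at_imp_continuous_on differentiable_imp_continuous_within)
next
  case (Suc k)
  then show ?case by (metis Ck_on.simps(2))
qed

section \<open>Closure of smooth maps under sums, bilinear products and reciprocals\<close>

lemma Ck_on_const: "Ck_on k S (\<lambda>x. c)"
  by (induction k arbitrary: c) (simp_all add: frechet_derivative_const)

lemma Ck_on_bounded_linear:
  assumes "bounded_linear f"
  shows "Ck_on k S f"
proof (cases k)
  case 0
  then show ?thesis using assms by (simp add: linear_continuous_on)
next
  case (Suc m)
  have "(f has_derivative f) (at x)" for x
    using assms by (rule bounded_linear_imp_has_derivative)
  then have "f differentiable (at x)" "frechet_derivative f (at x) = f" for x
    using frechet_derivative_at[of f f x] by (auto simp: differentiable_def)
  then show ?thesis by (simp add: Suc Ck_on_const)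
qed

lemma Ck_on_add:
  assumes "open S"
  shows "Ck_on k S f \<Longrightarrow> Ck_on k S g \<Longrightarrow> Ck_on k S (\<lambda>x. f x + g x)"
proof (induction k arbitrary: f g)
  case 0
  then show ?case by (simp add: continuous_on_add)
next
  case (Suc k)
  have D: "((\<lambda>x. f x + g x) has_derivative
      (\<lambda>v. frechet_derivative f (at x) v + frechet_derivative g (at x) v)) (at x)"
    if "x \<in> S" for x
    by (rule has_derivative_add)
      (use Suc.prems that in \<open>simp_all flip: frechet_derivative_works\<close>)
  have "Ck_on k S (\<lambda>x. frechet_derivative (\<lambda>x. f x + g x) (at x) v)" for v
  proof (rule Ck_on_cong[OF assms])
    show "Ck_on k S (\<lambda>x. frechet_derivative f (at x) v + frechet_derivative g (at x) v)"
      by (rule Suc.IH) (use Suc.prems in auto)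
    show "frechet_derivative f (at x) v + frechet_derivative g (at x) v =
        frechet_derivative (\<lambda>x. f x + g x) (at x) v" if "x \<in> S" for x
      using fun_cong[OF frechet_derivative_at[OF D[OF that]], of v] .
  qed
  with D show ?case by (auto simp: differentiable_def)
qed

text \<open>Covers real products, scalar multiples and inner products at once. The Leibniz rule
  pairs each undifferentiated factor with a derivative of the other, so the induction must leave
  both factors arbitrary and lower their order by \<open>Ck_on_SucD\<close>.\<close>

lemma Ck_on_bounded_bilinear:
  assumes "open S" "bounded_bilinear b"
  shows "Ck_on k S f \<Longrightarrow> Ck_on k S g \<Longrightarrow> Ck_on k S (\<lambda>x. b (f x) (g x))"
proof (induction k arbitrary: f g)
  case 0
  then show ?case by (simp add: bounded_bilinear.continuous_on[OF assms(2)])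
next
  case (Suc k)
  have D: "((\<lambda>x. b (f x) (g x)) has_derivative
      (\<lambda>v. b (f x) (frechet_derivative g (at x) v) + b (frechet_derivative f (at x) v) (g x))) (at x)"
    if "x \<in> S" for x
    by (rule bounded_bilinear.FDERIV[OF assms(2)])
      (use Suc.prems that in \<open>simp_all flip: frechet_derivative_works\<close>)
  have "Ck_on k S (\<lambda>x. frechet_derivative (\<lambda>x. b (f x) (g x)) (at x) v)" for v
  proof (rule Ck_on_cong[OF assms(1)])
    show "Ck_on k S (\<lambda>x. b (f x) (frechet_derivative g (at x) v)
        + b (frechet_derivative f (at x) v) (g x))"
      by (intro Ck_on_add[OF assms(1)] Suc.IH)
        (use Suc.prems Ck_on_SucD in \<open>auto simp del: Ck_on.simps(1)\<close>)
    show "b (f x) (frechet_derivative g (at x) v) + b (frechet_derivative f (at x) v) (g x) =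
        frechet_derivative (\<lambda>x. b (f x) (g x)) (at x) v" if "x \<in> S" for x
      using fun_cong[OF frechet_derivative_at[OF D[OF that]], of v] .
  qed
  with D show ?case by (auto simp: differentiable_def)
qed

text \<open>The derivative of \<open>1/f\<close> is a product of \<open>f'\<close> and two copies of
  \<open>1/f\<close>, and the induction hypothesis already gives \<open>1/f\<close> one order
  less.\<close>

lemma Ck_on_inverse:
  fixes f :: "'a::euclidean_space \<Rightarrow> real"
  assumes "open S" "\<And>x. x \<in> S \<Longrightarrow> f x \<noteq> 0"
  shows "Ck_on k S f \<Longrightarrow> Ck_on k S (\<lambda>x. inverse (f x))"
proof (induction k)
  case 0
  then show ?case using assms(2) by (simp add: continuous_on_inverse)
next
  case (Suc k)
  have D: "((\<lambda>x. inverse (f x)) has_derivative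
      (\<lambda>v. - (inverse (f x) * frechet_derivative f (at x) v * inverse (f x)))) (at x)"
    if "x \<in> S" for x
    by (rule Deriv.has_derivative_inverse)
      (use Suc.prems assms(2) that in \<open>simp_all flip: frechet_derivative_works\<close>)
  have I: "Ck_on k S (\<lambda>x. inverse (f x))"
    using Suc Ck_on_SucD by blast
  note mult = Ck_on_bounded_bilinear[OF assms(1) bounded_bilinear_mult]
  have "Ck_on k S (\<lambda>x. frechet_derivative (\<lambda>x. inverse (f x)) (at x) v)" for v
  proof (rule Ck_on_cong[OF assms(1)])
    \<comment> \<open>The sign is written as a constant factor, so that closure under products
      covers it.\<close>
    show "Ck_on k S (\<lambda>x. (- 1) *
        ((inverse (f x) * frechet_derivative f (at x) v) * inverse (f x)))"
      by (intro mult I Ck_on_const) (use Suc.prems in simp)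
    show "- 1 * ((inverse (f x) * frechet_derivative f (at x) v) * inverse (f x)) =
        frechet_derivative (\<lambda>x. inverse (f x)) (at x) v" if "x \<in> S" for x
      using fun_cong[OF frechet_derivative_at[OF D[OF that]], of v] by simp
  qed
  with D show ?case by (auto simp: differentiable_def)
qed

lemma smooth_on_const: "smooth_on S (\<lambda>x. c)"
  by (simp add: smooth_on_def Ck_on_const)

lemma smooth_on_add:
  "open S \<Longrightarrow> smooth_on S f \<Longrightarrow> smooth_on S g \<Longrightarrow> smooth_on S (\<lambda>x. f x + g x)"
  by (simp add: smooth_on_def Ck_on_add)

lemma smooth_on_bounded_linear: "bounded_linear f \<Longrightarrow> smooth_on S f"
  by (simp add: smooth_on_def Ck_on_bounded_linear)

lemma smooth_on_bounded_bilinear: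
  "open S \<Longrightarrow> bounded_bilinear b \<Longrightarrow> smooth_on S f \<Longrightarrow> smooth_on S g
    \<Longrightarrow> smooth_on S (\<lambda>x. b (f x) (g x))"
  by (simp add: smooth_on_def Ck_on_bounded_bilinear)

lemma smooth_on_inverse:
  fixes f :: "'a::euclidean_space \<Rightarrow> real"
  shows "open S \<Longrightarrow> (\<And>x. x \<in> S \<Longrightarrow> f x \<noteq> 0) \<Longrightarrow> smooth_on S f
    \<Longrightarrow> smooth_on S (\<lambda>x. inverse (f x))"
  by (simp add: smooth_on_def Ck_on_inverse)


section \<open>Charts and tangent spaces\<close>

context
  fixes T :: "'p topology" and A :: "('p, 'e::euclidean_space) chart set"
  assumes M: "smooth_manifold T A"
begin

lemma chart_inj_on:
  assumes "c \<in> A"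
  shows "inj_on (snd c) (fst c)"
proof -
  have "homeomorphic_map (subtopology T (fst c)) (top_of_set (snd c ` fst c)) (snd c)"
    and "fst c \<subseteq> topspace T"
    using M assms by (auto simp: smooth_manifold_def carrier_of_def)
  then show ?thesis
    using homeomorphic_imp_injective_map topspace_subtopology_subset by metis
qed

lemma chart_inv_chart: "c \<in> A \<Longrightarrow> p \<in> fst c \<Longrightarrow> chart_inv c (snd c p) = p"
  by (simp add: chart_inv_def chart_inj_on)

lemma transition_chart: "c \<in> A \<Longrightarrow> p \<in> fst c \<Longrightarrow> transition c d (snd c p) = snd d p"
  by (simp add: transition_def chart_inv_chart)

lemma open_chart_overlap:
  assumes "c \<in> A" "d \<in> A"
  shows "open (snd c ` (fst c \<inter> fst d))"
proof -
  have o: "openin T (fst c)" "openin T (fst d)" "open (snd c ` fst c)"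
    and h: "homeomorphic_map (subtopology T (fst c)) (top_of_set (snd c ` fst c)) (snd c)"
    using M assms by (auto simp: smooth_manifold_def)
  have "openin (subtopology T (fst c)) (fst c \<inter> fst d)"
    using o by (auto simp: openin_subtopology)
  with homeomorphic_imp_open_map[OF h]
  have "openin (top_of_set (snd c ` fst c)) (snd c ` (fst c \<inter> fst d))"
    by (simp add: open_map_def)
  with o(3) show ?thesis
    using openin_open_trans by blast
qed

lemma smooth_transition:
  "c \<in> A \<Longrightarrow> d \<in> A \<Longrightarrow> smooth_on (snd c ` (fst c \<inter> fst d)) (transition c d)"
  using M by (simp add: smooth_manifold_def)

lemma transition_differentiable:
  assumes "c \<in> A" "d \<in> A" "p \<in> fst c" "p \<in> fst d"
  shows "transition c d differentiable (at (snd c p))"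
  by (rule smooth_on_differentiable[OF smooth_transition[OF assms(1,2)]]) (use assms in blast)

lemma transition_cocycle:
  assumes "c \<in> A" "d \<in> A" "e \<in> A" "p \<in> fst c" "p \<in> fst d" "p \<in> fst e"
  shows "frechet_derivative (transition c e) (at (snd c p)) \<xi> =
    frechet_derivative (transition d e) (at (snd d p))
      (frechet_derivative (transition c d) (at (snd c p)) \<xi>)"
proof -
  let ?cd = "frechet_derivative (transition c d) (at (snd c p))"
  let ?de = "frechet_derivative (transition d e) (at (snd d p))"
  have "(transition c d has_derivative ?cd) (at (snd c p))"
    using transition_differentiable assms by (simp flip: frechet_derivative_works)
  moreover have "(transition d e has_derivative ?de) (at (transition c d (snd c p)))"
    using transition_differentiable assms
    by (simp add: transition_chart flip: frechet_derivative_works)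
  ultimately have "((\<lambda>x. transition d e (transition c d x)) has_derivative (\<lambda>x. ?de (?cd x))) (at (snd c p))"
    by (rule has_derivative_compose)
  then have "(transition c e has_derivative (\<lambda>x. ?de (?cd x))) (at (snd c p))"
  proof (rule has_derivative_transform_within_open)
    \<comment> \<open>The overlap of \<open>c\<close> and \<open>d\<close> is enough: for
      \<open>q\<close> in it both sides equal \<open>snd e q\<close>, even if \<open>q\<close> lies
      outside the domain of \<open>e\<close>.\<close>
    show "open (snd c ` (fst c \<inter> fst d))" "snd c p \<in> snd c ` (fst c \<inter> fst d)"
      using assms open_chart_overlap by auto
  qed (use assms in \<open>auto simp: transition_chart\<close>)
  from fun_cong[OF frechet_derivative_at[OF this], of \<xi>] show ?thesis
    by simp
qed

lemma transition_self:
  assumes "c \<in> A" "p \<in> fst c"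
  shows "frechet_derivative (transition c c) (at (snd c p)) \<xi> = \<xi>"
proof -
  have "((\<lambda>x. x) has_derivative (\<lambda>x. x)) (at (snd c p))"
    by (rule has_derivative_ident)
  then have "(transition c c has_derivative (\<lambda>x. x)) (at (snd c p))"
  proof (rule has_derivative_transform_within_open)
    show "open (snd c ` (fst c \<inter> fst c))" "snd c p \<in> snd c ` (fst c \<inter> fst c)"
      using assms open_chart_overlap by blast+
  qed (use assms in \<open>auto simp: transition_chart\<close>)
  from fun_cong[OF frechet_derivative_at[OF this], of \<xi>] show ?thesis
    by simp
qed

text \<open>Transport of prescribed components by the Jacobians; compatibility is the cocycle rule.
  This is what makes the fibre part of an induced chart surjective.\<close>

lemma tangent_vector_exists:
  assumes "c \<in> A" "p \<in> fst c"
  shows "\<exists>\<xi>\<in>tangent_space A p. \<xi> c = y"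
proof -
  define \<xi> where "\<xi> = (\<lambda>d. if d \<in> A \<and> p \<in> fst d then frechet_derivative (transition c d) (at (snd c p)) y else 0)"
  have "\<xi> c = y" using assms by (simp add: \<xi>_def transition_self)
  moreover have "\<xi> \<in> tangent_space A p"
    unfolding tangent_space_def \<xi>_def
    by (auto simp del: split_paired_All intro: transition_cocycle[OF assms(1) _ _ assms(2)])
  ultimately show ?thesis by blast
qed

end

lemma tangent_space_outside:
  "\<xi> \<in> tangent_space A p \<Longrightarrow> \<not> (c \<in> A \<and> p \<in> fst c) \<Longrightarrow> \<xi> c = 0"
  unfolding tangent_space_def by blast

lemma tangent_space_transition:
  "\<xi> \<in> tangent_space A p \<Longrightarrow> c \<in> A \<Longrightarrow> d \<in> A \<Longrightarrow> p \<in> fst c \<Longrightarrow> p \<in> fst d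
    \<Longrightarrow> \<xi> d = frechet_derivative (transition c d) (at (snd c p)) (\<xi> c)"
  unfolding tangent_space_def by blast

lemma tangent_space_eqI:
  assumes "\<xi> \<in> tangent_space A p" "\<zeta> \<in> tangent_space A p" "c \<in> A" "p \<in> fst c" "\<xi> c = \<zeta> c"
  shows "\<xi> = \<zeta>"
proof
  fix d show "\<xi> d = \<zeta> d"
  proof (cases "d \<in> A \<and> p \<in> fst d")
    case True
    then show ?thesis
      using tangent_space_transition[OF assms(1,3) _ assms(4), of d]
        tangent_space_transition[OF assms(2,3) _ assms(4), of d] assms(5) by simp
  next
    case False
    then show ?thesis
      using tangent_space_outside assms(1,2) by metis
  qed
qed

text \<open>Differentiability of the transitions makes their Jacobians linear. It is stated apart
  from \<open>smooth_manifold\<close> so that linear combinations of tangent vectors are available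
  for the slit atlas too.\<close>

definition C1_atlas :: "('p, 'e::euclidean_space) chart set \<Rightarrow> bool" where
  "C1_atlas A \<longleftrightarrow> (\<forall>c\<in>A. \<forall>d\<in>A. \<forall>p\<in>fst c \<inter> fst d. transition c d differentiable (at (snd c p)))"

lemma smooth_manifold_C1_atlas: "smooth_manifold T A \<Longrightarrow> C1_atlas A"
  by (simp add: C1_atlas_def transition_differentiable)

lemma tangent_space_lincomb:
  assumes "C1_atlas A" "\<xi> \<in> tangent_space A p" "\<zeta> \<in> tangent_space A p"
  shows "(\<lambda>c. a *\<^sub>R \<xi> c + b *\<^sub>R \<zeta> c) \<in> tangent_space A p"
proof -
  have "a *\<^sub>R \<xi> d + b *\<^sub>R \<zeta> d =
      frechet_derivative (transition c d) (at (snd c p)) (a *\<^sub>R \<xi> c + b *\<^sub>R \<zeta> c)"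
    if "c \<in> A" "d \<in> A" "p \<in> fst c" "p \<in> fst d" for c d
  proof -
    have "linear (frechet_derivative (transition c d) (at (snd c p)))"
      using assms(1) that by (intro linear_frechet_derivative) (auto simp: C1_atlas_def)
    then show ?thesis
      using tangent_space_transition[OF assms(2) that] tangent_space_transition[OF assms(3) that]
      by (simp add: linear_add linear_cmul)
  qed
  moreover have "a *\<^sub>R \<xi> c + b *\<^sub>R \<zeta> c = 0" if "\<not> (c \<in> A \<and> p \<in> fst c)" for c
    using tangent_space_outside[OF assms(2) that] tangent_space_outside[OF assms(3) that] by simp
  ultimately show ?thesis
    unfolding tangent_space_def by blast
qed

lemma tangent_space_scale:
  assumes "C1_atlas A" "\<xi> \<in> tangent_space A p"
  shows "(\<lambda>c. a *\<^sub>R \<xi> c) \<in> tangent_space A p"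
  using tangent_space_lincomb[OF assms assms(2), of a 0] by simp


section \<open>The slit tangent bundle\<close>

lemma fst_induced_chart:
  "fst (induced_chart A c) = {v \<in> slit_tangent_bundle A. fst v \<in> fst c}"
  by (simp add: induced_chart_def)

lemma snd_induced_chart: "snd (induced_chart A c) v = (snd c (fst v), snd v c)"
  by (simp add: induced_chart_def)

lemma carrier_of_slit_atlas: "carrier_of (slit_atlas A) = slit_tangent_bundle A"
  by (auto simp: carrier_of_def slit_atlas_def fst_induced_chart slit_tangent_bundle_def
      tangent_bundle_def)

lemma slit_tangent_bundle_iff:
  "(p, \<xi>) \<in> slit_tangent_bundle A \<longleftrightarrow> p \<in> carrier_of A \<and> \<xi> \<in> tangent_space A p \<and> \<xi> \<noteq> (\<lambda>_. 0)"
  by (auto simp: slit_tangent_bundle_def tangent_bundle_def)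

lemma slit_chart_at:
  assumes "v \<in> slit_tangent_bundle A"
  shows "chart_at (slit_atlas A) v \<in> slit_atlas A" "v \<in> fst (chart_at (slit_atlas A) v)"
proof -
  have "\<exists>d. d \<in> slit_atlas A \<and> v \<in> fst d"
    using assms unfolding carrier_of_slit_atlas[symmetric] carrier_of_def by blast
  then show "chart_at (slit_atlas A) v \<in> slit_atlas A" "v \<in> fst (chart_at (slit_atlas A) v)"
    unfolding chart_at_def by (metis (mono_tags, lifting) someI_ex)+
qed

context
  fixes T :: "'m topology" and A :: "('m, 'e::euclidean_space) chart set"
  assumes M: "smooth_manifold T A"
begin

text \<open>The slit bundle excludes the vector that vanishes in every chart. Vanishing in one chart
  is already the same, because the components in one chart determine the vector.\<close>

lemma slit_fibre_nonzero:
  assumes "c \<in> A" "v \<in> fst (induced_chart A c)"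
  shows "snd v c \<noteq> 0"
proof
  assume "snd v c = 0"
  moreover have "snd v \<in> tangent_space A (fst v)"
    using assms(2) by (auto simp: fst_induced_chart slit_tangent_bundle_def tangent_bundle_def)
  moreover from tangent_space_scale[OF smooth_manifold_C1_atlas[OF M] this, of 0]
  have "(\<lambda>_. 0) \<in> tangent_space A (fst v)" by simp
  ultimately have "snd v = (\<lambda>_. 0)"
    using assms tangent_space_eqI[of "snd v" A "fst v" "\<lambda>_. 0" c] by (simp add: fst_induced_chart)
  then show False
    using assms(2) by (simp add: fst_induced_chart slit_tangent_bundle_def)
qed

lemma induced_chart_inv:
  assumes "c \<in> A" "v \<in> fst (induced_chart A c)"
  shows "chart_inv (induced_chart A c) (snd (induced_chart A c) v) = v"
proof -
  have "inj_on (snd (induced_chart A c)) (fst (induced_chart A c))"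
  proof (rule inj_onI)
    fix v w assume vw: "v \<in> fst (induced_chart A c)" "w \<in> fst (induced_chart A c)"
      and eq: "snd (induced_chart A c) v = snd (induced_chart A c) w"
    have p: "fst v = fst w"
      by (rule inj_onD[OF chart_inj_on[OF M assms(1)]])
        (use eq vw in \<open>auto simp: fst_induced_chart snd_induced_chart\<close>)
    moreover have "snd v = snd w"
      using eq vw p assms(1) tangent_space_eqI[of "snd v" A "fst v" "snd w" c]
      by (auto simp: fst_induced_chart snd_induced_chart slit_tangent_bundle_def tangent_bundle_def)
    ultimately show "v = w" by (simp add: prod_eq_iff)
  qed
  then show ?thesis
    using assms(2) by (simp add: chart_inv_def)
qed

text \<open>Membership in an induced chart constrains only the base point. The product form gives
  openness of the overlaps, on which the local arguments on the slit bundle rest.\<close>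

lemma induced_overlap:
  assumes "c \<in> A" "d \<in> A"
  shows "snd (induced_chart A c) ` (fst (induced_chart A c) \<inter> fst (induced_chart A d)) =
    snd c ` (fst c \<inter> fst d) \<times> (- {0})" (is "?L = ?R")
proof
  show "?L \<subseteq> ?R"
    using slit_fibre_nonzero[OF assms(1)] by (auto simp: fst_induced_chart snd_induced_chart)
  show "?R \<subseteq> ?L"
  proof (rule subsetI)
    fix z assume "z \<in> ?R"
    then obtain p y where z: "z = (snd c p, y)" and p: "p \<in> fst c" "p \<in> fst d" and "y \<noteq> 0"
      by auto
    obtain \<xi> where \<xi>: "\<xi> \<in> tangent_space A p" "\<xi> c = y"
      using tangent_vector_exists[OF M assms(1) p(1)] by blast
    have "(p, \<xi>) \<in> slit_tangent_bundle A"
      using \<xi> \<open>y \<noteq> 0\<close> p assms by (auto simp: slit_tangent_bundle_iff carrier_of_def)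
    then show "z \<in> ?L"
      unfolding z using p \<xi>(2) by (intro image_eqI[of _ _ "(p, \<xi>)"]) (auto simp: fst_induced_chart snd_induced_chart)
  qed
qed

lemma open_induced_overlap:
  "c \<in> A \<Longrightarrow> d \<in> A \<Longrightarrow>
    open (snd (induced_chart A c) ` (fst (induced_chart A c) \<inter> fst (induced_chart A d)))"
  unfolding induced_overlap by (intro open_Times open_chart_overlap[OF M]) auto

lemma open_slit_chart: "d \<in> slit_atlas A \<Longrightarrow> open (snd d ` fst d)"
  unfolding slit_atlas_def using open_induced_overlap by (metis Int_absorb imageE)

lemma slit_chart_inv: "d \<in> slit_atlas A \<Longrightarrow> v \<in> fst d \<Longrightarrow> chart_inv d (snd d v) = v"
  unfolding slit_atlas_def using induced_chart_inv by blast

lemma induced_chart_change: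
  assumes "c \<in> A" "d \<in> A" "v \<in> fst (induced_chart A c)" "v \<in> fst (induced_chart A d)"
  shows "snd (induced_chart A d) v =
    (transition c d (snd c (fst v)),
     frechet_derivative (transition c d) (at (snd c (fst v))) (snd v c))"
proof -
  have "snd v \<in> tangent_space A (fst v)" "fst v \<in> fst c" "fst v \<in> fst d"
    using assms(3,4) by (auto simp: fst_induced_chart slit_tangent_bundle_def tangent_bundle_def)
  then show ?thesis
    using assms tangent_space_transition[of "snd v" A "fst v" c d]
    by (simp add: transition_chart[OF M] snd_induced_chart)
qed

lemma induced_transition:
  "c \<in> A \<Longrightarrow> v \<in> fst (induced_chart A c) \<Longrightarrow>
    transition (induced_chart A c) d (snd (induced_chart A c) v) = snd d v"
  by (simp add: transition_def induced_chart_inv)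

text \<open>The coordinate change is \<open>(x, y) \<mapsto> (\<phi> x, D\<phi>(x) y)\<close>; second derivatives of \<open>\<phi>\<close> only act on the
  horizontal component of a tangent vector.\<close>

lemma induced_transition_derivative:
  assumes "c \<in> A" "d \<in> A" "v \<in> fst (induced_chart A c)" "v \<in> fst (induced_chart A d)"
  defines "\<tau> \<equiv> transition (induced_chart A c) (induced_chart A d)"
    and "u \<equiv> snd (induced_chart A c) v"
  shows "\<tau> differentiable (at u)"
    and "frechet_derivative \<tau> (at u) (0, b) =
      (0, frechet_derivative (transition c d) (at (snd c (fst v))) b)"
proof -
  define \<phi> where "\<phi> = transition c d"
  define x where "x = snd c (fst v)"
  have xO: "x \<in> snd c ` (fst c \<inter> fst d)"
    using assms(3,4) by (auto simp: x_def fst_induced_chart)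
  have d\<phi>: "\<phi> differentiable (at x')" if "x' \<in> snd c ` (fst c \<inter> fst d)" for x'
    unfolding \<phi>_def by (rule smooth_on_differentiable[OF smooth_transition[OF M assms(1,2)] that])
  have dd\<phi>: "(\<lambda>x. frechet_derivative \<phi> (at x) i) differentiable (at x)" for i
    unfolding \<phi>_def
    by (rule smooth_on_differentiable[OF smooth_on_frechet_derivative[OF
          smooth_transition[OF M assms(1,2)]] xO])
  define H where "H i = frechet_derivative (\<lambda>x. frechet_derivative \<phi> (at x) i) (at x)" for i
  have uO: "u \<in> snd (induced_chart A c) ` (fst (induced_chart A c) \<inter> fst (induced_chart A d))"
    using assms(3,4) by (simp add: u_def)
  have fu: "fst u = x" by (simp add: u_def x_def snd_induced_chart)
  have D1: "((\<lambda>u. \<phi> (fst u)) has_derivative (\<lambda>w. frechet_derivative \<phi> (at x) (fst w))) (at u)"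
    by (rule has_derivative_compose[of fst fst]) (use d\<phi>[OF xO] in
        \<open>auto simp: fu frechet_derivative_works[symmetric] intro: has_derivative_fst\<close>)
  have D2: "((\<lambda>u. frechet_derivative \<phi> (at (fst u)) i) has_derivative (\<lambda>w. H i (fst w))) (at u)" for i
    by (rule has_derivative_compose[of fst fst]) (use dd\<phi> in
        \<open>auto simp: fu H_def frechet_derivative_works[symmetric] intro: has_derivative_fst\<close>)
  \<comment> \<open>Smoothness of \<open>\<phi>\<close> controls its derivative in a fixed direction
    only, so \<open>D\<phi>(x) y\<close> is expanded over the basis before it is differentiated in
    \<open>x\<close>.\<close>
  have "((\<lambda>u. (\<phi> (fst u), \<Sum>i\<in>Basis. (snd u \<bullet> i) *\<^sub>R frechet_derivative \<phi> (at (fst u)) i))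
      has_derivative (\<lambda>w. (frechet_derivative \<phi> (at x) (fst w),
        \<Sum>i\<in>Basis. (snd u \<bullet> i) *\<^sub>R H i (fst w)
          + (snd w \<bullet> i) *\<^sub>R frechet_derivative \<phi> (at (fst u)) i))) (at u)"
    by (intro has_derivative_Pair D1 has_derivative_sum has_derivative_scaleR D2
        has_derivative_inner_left has_derivative_snd has_derivative_ident)
  moreover
  have "(\<phi> (fst u'), \<Sum>i\<in>Basis. (snd u' \<bullet> i) *\<^sub>R frechet_derivative \<phi> (at (fst u')) i) = \<tau> u'"
    if u': "u' \<in> snd (induced_chart A c) ` (fst (induced_chart A c) \<inter> fst (induced_chart A d))" for u'
  proof -
    obtain v' where v': "v' \<in> fst (induced_chart A c)" "v' \<in> fst (induced_chart A d)"
      and [simp]: "u' = snd (induced_chart A c) v'"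
      using u' by blast
    have "linear (frechet_derivative \<phi> (at (fst u')))"
      using v' by (intro linear_frechet_derivative d\<phi>) (auto simp: fst_induced_chart snd_induced_chart)
    from linear_sum[OF this, of "\<lambda>i. (snd u' \<bullet> i) *\<^sub>R i" Basis] linear_cmul[OF this]
    have "(\<Sum>i\<in>Basis. (snd u' \<bullet> i) *\<^sub>R frechet_derivative \<phi> (at (fst u')) i) =
        frechet_derivative \<phi> (at (fst u')) (snd u')"
      by (simp add: euclidean_representation)
    then show ?thesis
      using induced_transition[OF assms(1) v'(1)] induced_chart_change[OF assms(1,2) v']
      by (simp add: \<tau>_def \<phi>_def snd_induced_chart)
  qed
  ultimately have D: "(\<tau> has_derivative (\<lambda>w. (frechet_derivative \<phi> (at x) (fst w),
        \<Sum>i\<in>Basis. (snd u \<bullet> i) *\<^sub>R H i (fst w)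
          + (snd w \<bullet> i) *\<^sub>R frechet_derivative \<phi> (at (fst u)) i))) (at u)"
    by (rule has_derivative_transform_within_open[OF _ open_induced_overlap[OF assms(1,2)] uO])
  then show "\<tau> differentiable (at u)" by (auto simp: differentiable_def)
  have lin: "linear (frechet_derivative \<phi> (at x))" "linear (H i)" for i
    unfolding H_def by (intro linear_frechet_derivative d\<phi> xO dd\<phi>)+
  have "(\<Sum>i\<in>Basis. (b \<bullet> i) *\<^sub>R frechet_derivative \<phi> (at x) i) = frechet_derivative \<phi> (at x) b"
    using linear_sum[OF lin(1), of "\<lambda>i. (b \<bullet> i) *\<^sub>R i" Basis] linear_cmul[OF lin(1)]
    by (simp add: euclidean_representation)
  then show "frechet_derivative \<tau> (at u) (0, b) =
      (0, frechet_derivative (transition c d) (at (snd c (fst v))) b)"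
    using fun_cong[OF frechet_derivative_at[OF D], of "(0, b)"]
    by (simp add: fu linear_0[OF lin(1)] linear_0[OF lin(2)] \<phi>_def[symmetric] x_def[symmetric])
qed

lemma C1_slit_atlas: "C1_atlas (slit_atlas A)"
  by (auto simp: C1_atlas_def slit_atlas_def intro: induced_transition_derivative(1))

section \<open>Vertical vectors, vertical sections and their brackets\<close>

lemma vertical_lincomb:
  "w \<in> vertical A v \<Longrightarrow> w' \<in> vertical A v \<Longrightarrow> (\<lambda>d. a *\<^sub>R w d + b *\<^sub>R w' d) \<in> vertical A v"
  by (auto simp: vertical_def tangent_space_lincomb[OF C1_slit_atlas])

lemma vertical_transition:
  assumes "w \<in> vertical A v"
    and "c \<in> A" "d \<in> A" "v \<in> fst (induced_chart A c)" "v \<in> fst (induced_chart A d)"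
  shows "w (induced_chart A d) =
    (0, frechet_derivative (transition c d) (at (snd c (fst v))) (snd (w (induced_chart A c))))"
proof -
  have "w (induced_chart A c) = (0, snd (w (induced_chart A c)))"
    using assms by (auto simp: vertical_def slit_atlas_def prod_eq_iff)
  moreover have "w (induced_chart A d) =
      frechet_derivative (transition (induced_chart A c) (induced_chart A d))
        (at (snd (induced_chart A c) v)) (w (induced_chart A c))"
    using assms by (intro tangent_space_transition) (auto simp: vertical_def slit_atlas_def)
  ultimately show ?thesis
    using induced_transition_derivative(2)[OF assms(2-5)] by metis
qed

lemma section_differentiable:
  assumes "Y \<in> sections (slit_atlas A) D" "d \<in> slit_atlas A" "v \<in> fst d"
  shows "(\<lambda>u. Y (chart_inv d u) d) differentiable (at (snd d v))"
  by (rule smooth_on_differentiable[of "snd d ` fst d"])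
    (use assms in \<open>auto simp: sections_def vector_fields_def\<close>)

lemma line_in_chart_overlap:
  assumes "c \<in> A" "d \<in> A" "v \<in> fst (induced_chart A c)" "v \<in> fst (induced_chart A d)"
  shows "\<forall>\<^sub>F s in at (0::real). snd (induced_chart A c) v + s *\<^sub>R w
    \<in> snd (induced_chart A c) ` (fst (induced_chart A c) \<inter> fst (induced_chart A d))"
proof -
  have "((\<lambda>s. snd (induced_chart A c) v + s *\<^sub>R w) \<longlongrightarrow> snd (induced_chart A c) v + 0 *\<^sub>R w) (at (0::real))"
    by (intro tendsto_intros)
  then show ?thesis
    by (rule topological_tendstoD[OF _ open_induced_overlap[OF assms(1,2)]]) (use assms in auto)
qed

text \<open>The horizontal components vanish identically on an open set, so their derivative
  vanishes in every direction, vertical or not.\<close>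

lemma vertical_section_derivative_vertical:
  assumes Y: "Y \<in> sections (slit_atlas A) (vertical A)" and d: "d \<in> slit_atlas A" "v \<in> fst d"
  shows "fst (frechet_derivative (\<lambda>u. Y (chart_inv d u) d) (at (snd d v)) w) = 0"
proof -
  let ?Y = "\<lambda>u. Y (chart_inv d u) d"
  have diff: "?Y differentiable (at (snd d v))"
    using section_differentiable[OF Y d] .
  then have "((\<lambda>u. fst (?Y u)) has_derivative
      (\<lambda>w. fst (frechet_derivative ?Y (at (snd d v)) w))) (at (snd d v))"
    unfolding frechet_derivative_works by (rule has_derivative_fst)
  moreover have "fst (?Y u) = 0" if "u \<in> snd d ` fst d" for u
    using that Y d(1) slit_chart_inv[OF d(1)]
    by (auto simp: sections_def vertical_def carrier_of_def)
  ultimately have "((\<lambda>u. 0) has_derivative (\<lambda>w. fst (frechet_derivative ?Y (at (snd d v)) w))) (at (snd d v))"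
    by (rule has_derivative_transform_within_open[OF _ open_slit_chart[OF d(1)] imageI[OF d(2)]])
  from has_derivative_unique[OF this has_derivative_const] show ?thesis by metis
qed

text \<open>Along a fibre the Jacobian \<open>P\<close> of the base change is constant. The segment
  through \<open>v\<close> and the components of \<open>Y\<close> on it therefore transform by the
  same linear map, and so does the derivative of \<open>Y\<close> along the segment: it is tensorial
  in itself.\<close>

lemma vertical_section_derivative_transition:
  fixes Y :: "(('m, 'e) tpoint, 'e \<times> 'e) vfield"
  assumes Y: "Y \<in> sections (slit_atlas A) (vertical A)" and w: "w \<in> vertical A v"
    and cd: "c \<in> A" "d \<in> A" "v \<in> fst (induced_chart A c)" "v \<in> fst (induced_chart A d)"
  defines "c' \<equiv> induced_chart A c" and "d' \<equiv> induced_chart A d"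
  shows "frechet_derivative (\<lambda>u. Y (chart_inv d' u) d') (at (snd d' v)) (w d') =
    (0, frechet_derivative (transition c d) (at (snd c (fst v)))
      (snd (frechet_derivative (\<lambda>u. Y (chart_inv c' u) c') (at (snd c' v)) (w c'))))"
proof -
  define P where "P = frechet_derivative (transition c d) (at (snd c (fst v)))"
  define Yc where "Yc = (\<lambda>u. Y (chart_inv c' u) c')"
  define Yd where "Yd = (\<lambda>u. Y (chart_inv d' u) d')"
  have in_atlas: "c' \<in> slit_atlas A" "d' \<in> slit_atlas A" "v \<in> fst c'" "v \<in> fst d'"
    using cd by (auto simp: c'_def d'_def slit_atlas_def)
  have linP: "linear P"
    unfolding P_def using cd
    by (intro linear_frechet_derivative transition_differentiable[OF M]) (auto simp: fst_induced_chart)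
  have wc: "w c' = (0, snd (w c'))"
    using w in_atlas by (auto simp: vertical_def prod_eq_iff)
  have wd: "w d' = (0, P (snd (w c')))"
    using vertical_transition[OF w cd] by (simp add: P_def c'_def d'_def)
  have vd: "snd d' v = (transition c d (snd c (fst v)), P (snd v c))"
    using induced_chart_change[OF cd] by (simp add: d'_def P_def)
  have "\<forall>\<^sub>F s in at 0. Yd (snd d' v + s *\<^sub>R w d') = (0, P (snd (Yc (snd c' v + s *\<^sub>R w c'))))"
    using line_in_chart_overlap[OF cd, of "w c'"]
  proof (rule eventually_mono)
    fix s :: real
    assume "snd (induced_chart A c) v + s *\<^sub>R w c'
      \<in> snd (induced_chart A c) ` (fst (induced_chart A c) \<inter> fst (induced_chart A d))"
    then obtain q where q: "q \<in> fst c'" "q \<in> fst d'" "snd c' v + s *\<^sub>R w c' = snd c' q"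
      by (auto simp: c'_def d'_def)
    \<comment> \<open>Since \<open>w\<close> is vertical, the segment does not move the base point,
      so \<open>P\<close> is the Jacobian at \<open>q\<close> as well.\<close>
    have base: "snd c (fst q) = snd c (fst v)" and fib: "snd q c = snd v c + s *\<^sub>R snd (w c')"
      using q(3) arg_cong[OF wc, of fst] by (auto simp: c'_def snd_induced_chart prod_eq_iff)
    have qd: "snd d' q = snd d' v + s *\<^sub>R w d'"
      using induced_chart_change[OF cd(1,2), of q] q(1,2) vd wd
      by (simp add: c'_def d'_def base fib linear_add[OF linP] linear_cmul[OF linP] flip: P_def)
    have "Y q \<in> vertical A q"
      using Y q in_atlas by (auto simp: sections_def carrier_of_def)
    from vertical_transition[OF this cd(1,2)] q(1,2)
    have "Y q d' = (0, P (snd (Y q c')))"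
      by (simp add: c'_def d'_def base P_def)
    then show "Yd (snd d' v + s *\<^sub>R w d') = (0, P (snd (Yc (snd c' v + s *\<^sub>R w c'))))"
      using q in_atlas slit_chart_inv by (simp add: Yd_def Yc_def flip: qd)
  qed
  moreover have "Yd (snd d' v + 0 *\<^sub>R w d') = (0, P (snd (Yc (snd c' v + 0 *\<^sub>R w c'))))"
  proof -
    have "Y v \<in> vertical A v"
      using Y in_atlas by (auto simp: sections_def carrier_of_def)
    from vertical_transition[OF this cd] show ?thesis
      using in_atlas slit_chart_inv by (simp add: Yd_def Yc_def P_def c'_def d'_def)
  qed
  moreover have "((\<lambda>s. Yd (snd d' v + s *\<^sub>R w d')) has_vector_derivative
      frechet_derivative Yd (at (snd d' v)) (w d')) (at 0)"
    unfolding Yd_def using section_differentiable[OF Y] in_atlas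
    by (intro frechet_derivative_along_line)
  moreover have "((\<lambda>s. (0::'e, P (snd (Yc (snd c' v + s *\<^sub>R w c'))))) has_vector_derivative
      (0, P (snd (frechet_derivative Yc (at (snd c' v)) (w c'))))) (at 0)"
  proof -
    have "((\<lambda>s. Yc (snd c' v + s *\<^sub>R w c')) has_vector_derivative
        frechet_derivative Yc (at (snd c' v)) (w c')) (at 0)"
      unfolding Yc_def using section_differentiable[OF Y] in_atlas
      by (intro frechet_derivative_along_line)
    moreover have "bounded_linear (\<lambda>z. (0::'e, P (snd z)))" for z :: "'e \<times> 'e"
      using linP by (intro bounded_linear_Pair bounded_linear_zero
          bounded_linear_compose[OF _ bounded_linear_snd]) (simp add: linear_conv_bounded_linear)
    ultimately show ?thesis
      using bounded_linear.has_vector_derivative by fastforce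
  qed
  ultimately show ?thesis
    unfolding Yd_def[symmetric] Yc_def[symmetric] P_def[symmetric]
    by (rule has_vector_derivative_unique_eventually)
qed

text \<open>The content is that the coordinate formula defines a tangent vector at all. Each of its
  two halves transforms correctly by itself, being the derivative of a vertical field in a vertical
  direction.\<close>

lemma lie_bracket_vertical:
  assumes XY: "X \<in> sections (slit_atlas A) (vertical A)" "Y \<in> sections (slit_atlas A) (vertical A)"
    and v: "v \<in> slit_tangent_bundle A"
  shows "lie_bracket (slit_atlas A) X Y v \<in> vertical A v"
proof -
  let ?W = "lie_bracket (slit_atlas A) X Y v"
  have vert: "X v \<in> vertical A v" "Y v \<in> vertical A v"
    using XY v by (auto simp: sections_def carrier_of_slit_atlas)
  have fst0: "fst (?W d) = 0" if "d \<in> slit_atlas A" "v \<in> fst d" for d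
    using that vertical_section_derivative_vertical[OF XY(1) that]
      vertical_section_derivative_vertical[OF XY(2) that] by (simp add: lie_bracket_def)
  have "?W (induced_chart A d) =
      frechet_derivative (transition (induced_chart A c) (induced_chart A d))
        (at (snd (induced_chart A c) v)) (?W (induced_chart A c))"
    if cd: "c \<in> A" "d \<in> A" "v \<in> fst (induced_chart A c)" "v \<in> fst (induced_chart A d)" for c d
  proof -
    have atlas: "induced_chart A c \<in> slit_atlas A" "induced_chart A d \<in> slit_atlas A"
      using cd by (auto simp: slit_atlas_def)
    have "linear (frechet_derivative (transition c d) (at (snd c (fst v))))"
      using cd by (intro linear_frechet_derivative transition_differentiable[OF M])
        (auto simp: fst_induced_chart)
    then have "?W (induced_chart A d) =
        (0, frechet_derivative (transition c d) (at (snd c (fst v))) (snd (?W (induced_chart A c))))"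
      using vertical_section_derivative_transition[OF XY(2) vert(1) cd]
        vertical_section_derivative_transition[OF XY(1) vert(2) cd] atlas cd
      by (simp add: lie_bracket_def linear_diff)
    also have "\<dots> = frechet_derivative (transition (induced_chart A c) (induced_chart A d))
        (at (snd (induced_chart A c) v)) (0, snd (?W (induced_chart A c)))"
      using induced_transition_derivative(2)[OF cd] by simp
    also have "(0, snd (?W (induced_chart A c))) = ?W (induced_chart A c)"
      using fst0[OF atlas(1) cd(3)] by (simp add: prod_eq_iff)
    finally show ?thesis .
  qed
  then have "\<forall>c\<in>slit_atlas A. \<forall>d\<in>slit_atlas A. v \<in> fst c \<longrightarrow> v \<in> fst d \<longrightarrow>
      ?W d = frechet_derivative (transition c d) (at (snd c v)) (?W c)"
    unfolding slit_atlas_def by blast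
  moreover have "\<forall>c. \<not> (c \<in> slit_atlas A \<and> v \<in> fst c) \<longrightarrow> ?W c = 0"
    by (simp add: lie_bracket_def)
  ultimately have "?W \<in> tangent_space (slit_atlas A) v"
    unfolding tangent_space_def by blast
  with fst0 show ?thesis by (simp add: vertical_def)
qed

end


section \<open>The Liouville field\<close>

context
  fixes T :: "'m topology" and A :: "('m, 'e::euclidean_space) chart set"
  assumes M: "smooth_manifold T A"
begin

lemma liouville_chart_inv:
  assumes "d \<in> slit_atlas A" "u \<in> snd d ` fst d"
  shows "liouville A (chart_inv d u) d = (0, snd u)"
  using assms slit_chart_inv[OF M assms(1)] by (auto simp: liouville_def)

lemma liouville_nonzero:
  assumes "d \<in> slit_atlas A" "v \<in> fst d"
  shows "snd (snd d v) \<noteq> 0"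
proof -
  obtain c where "c \<in> A" "d = induced_chart A c"
    using assms(1) unfolding slit_atlas_def by blast
  then show ?thesis
    using slit_fibre_nonzero[OF M, of c v] assms(2) by (simp add: snd_induced_chart)
qed

text \<open>The fibre coordinate of a point and the vertical components of a vector transform by the
  same Jacobian, so one may be read as the other.\<close>

lemma liouville_vertical: "liouville A v \<in> vertical A v"
proof -
  have "liouville A v (induced_chart A d) =
      frechet_derivative (transition (induced_chart A c) (induced_chart A d))
        (at (snd (induced_chart A c) v)) (liouville A v (induced_chart A c))"
    if cd: "c \<in> A" "d \<in> A" "v \<in> fst (induced_chart A c)" "v \<in> fst (induced_chart A d)" for c d
    using induced_transition_derivative(2)[OF M cd] induced_chart_change[OF M cd] cd
    by (simp add: liouville_def slit_atlas_def snd_induced_chart)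
  then have "\<forall>c\<in>slit_atlas A. \<forall>d\<in>slit_atlas A. v \<in> fst c \<longrightarrow> v \<in> fst d \<longrightarrow> liouville A v d =
      frechet_derivative (transition c d) (at (snd c v)) (liouville A v c)"
    unfolding slit_atlas_def by blast
  moreover have "\<forall>c. \<not> (c \<in> slit_atlas A \<and> v \<in> fst c) \<longrightarrow> liouville A v c = 0"
    by (simp add: liouville_def)
  ultimately have "liouville A v \<in> tangent_space (slit_atlas A) v"
    unfolding tangent_space_def by blast
  then show ?thesis
    by (simp add: vertical_def liouville_def)
qed

lemma liouville_vector_field: "liouville A \<in> vector_fields (slit_atlas A)"
proof -
  have "smooth_on (snd d ` fst d) (\<lambda>u. liouville A (chart_inv d u) d)" if d: "d \<in> slit_atlas A" for d
  proof (rule smooth_on_cong[OF open_slit_chart[OF M d]])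
    show "smooth_on (snd d ` fst d) (\<lambda>u. (0::'e, snd u))"
      by (intro smooth_on_bounded_linear bounded_linear_Pair bounded_linear_zero bounded_linear_snd)
  qed (simp add: liouville_chart_inv d)
  moreover have "liouville A v = (\<lambda>_. 0)" if "v \<notin> carrier_of (slit_atlas A)" for v
  proof -
    have "\<not> (d \<in> slit_atlas A \<and> v \<in> fst d)" for d
      using that unfolding carrier_of_def by blast
    then show ?thesis by (simp add: liouville_def cong: conj_cong)
  qed
  ultimately show ?thesis
    using liouville_vertical by (auto simp: vector_fields_def vertical_def)
qed

lemma liouville_section_line: "liouville A \<in> sections (slit_atlas A) (liouville_line A)"
  unfolding sections_def liouville_line_def
  using liouville_vector_field by (auto intro: exI[of _ 1])

lemma liouville_section_vertical: "liouville A \<in> sections (slit_atlas A) (vertical A)"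
  unfolding sections_def using liouville_vector_field liouville_vertical by auto

lemma liouville_line_vertical: "liouville_line A v \<subseteq> vertical A v"
  using vertical_lincomb[OF M liouville_vertical[of v] liouville_vertical[of v], of _ 0]
  by (auto simp: liouville_line_def)

text \<open>In induced coordinates \<Gamma> is the linear map
  \<open>(x, y) \<mapsto> (0, y)\<close>, hence its own derivative; this produces the second
  term.\<close>

lemma lie_bracket_liouville:
  assumes d: "d \<in> slit_atlas A" "v \<in> fst d"
  shows "lie_bracket (slit_atlas A) (liouville A) Z v d =
    frechet_derivative (\<lambda>u. Z (chart_inv d u) d) (at (snd d v)) (0, snd (snd d v)) - (0, snd (Z v d))"
proof -
  have "((\<lambda>u. (0::'e, snd u)) has_derivative (\<lambda>w. (0, snd w))) (at (snd d v))"
    by (intro has_derivative_Pair has_derivative_const has_derivative_snd has_derivative_ident)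
  then have "((\<lambda>u. liouville A (chart_inv d u) d) has_derivative (\<lambda>w. (0, snd w))) (at (snd d v))"
    by (rule has_derivative_transform_within_open[OF _ open_slit_chart[OF M d(1)] imageI[OF d(2)]])
      (simp add: liouville_chart_inv d)
  from fun_cong[OF frechet_derivative_at[OF this], of "Z v d"] show ?thesis
    using d by (simp add: lie_bracket_def liouville_def)
qed

text \<open>The coefficient is recovered as \<open>(X \<bullet> y) / (y \<bullet> y)\<close> with
  the Euclidean inner product of the fibre coordinates. Any pairing positive on \<open>y\<close>
  would give the same quotient, and this one is visibly smooth.\<close>

lemma liouville_line_section:
  assumes X: "X \<in> sections (slit_atlas A) (liouville_line A)"
  shows "\<exists>f\<in>smooth_functions (slit_atlas A). X = vf_scale f (liouville A)"
proof -
  have "\<exists>t. X v = (\<lambda>d. t *\<^sub>R liouville A v d)" for v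
  proof (cases "v \<in> carrier_of (slit_atlas A)")
    case True
    then show ?thesis using X by (auto simp: sections_def liouville_line_def)
  next
    case False
    then have "X v = (\<lambda>_. 0)"
      using X unfolding sections_def vector_fields_def by blast
    then show ?thesis by (intro exI[of _ 0]) simp
  qed
  then obtain f where f: "\<And>v. X v = (\<lambda>d. f v *\<^sub>R liouville A v d)" by metis
  have "smooth_on (snd d ` fst d) (f \<circ> chart_inv d)" if d: "d \<in> slit_atlas A" for d
  proof (rule smooth_on_cong[OF open_slit_chart[OF M d]])
    let ?S = "snd d ` fst d"
    note open_S = open_slit_chart[OF M d]
    have X_smooth: "smooth_on ?S (\<lambda>u. X (chart_inv d u) d)"
      using X d by (simp add: sections_def vector_fields_def)
    have snd_smooth: "smooth_on ?S snd"
      by (rule smooth_on_bounded_linear[OF bounded_linear_snd])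
    have nz: "snd u \<bullet> snd u \<noteq> 0" if "u \<in> ?S" for u
      using that liouville_nonzero[OF d] by auto
    \<comment> \<open>Smoothness is given for the full component vector of \<open>X\<close>, so the
      passage to its fibre part is built into the bilinear map.\<close>
    have bil: "bounded_bilinear (\<lambda>(w::'e \<times> 'e) y. snd w \<bullet> y)"
      using bounded_bilinear.comp1[OF bounded_bilinear_inner bounded_linear_snd] .
    show "smooth_on ?S (\<lambda>u. (snd (X (chart_inv d u) d) \<bullet> snd u) * inverse (snd u \<bullet> snd u))"
      by (intro smooth_on_bounded_bilinear[OF open_S bounded_bilinear_mult]
          smooth_on_bounded_bilinear[OF open_S bil] smooth_on_inverse open_S nz X_smooth snd_smooth
          smooth_on_bounded_bilinear[OF open_S bounded_bilinear_inner])
    show "(snd (X (chart_inv d u) d) \<bullet> snd u) * inverse (snd u \<bullet> snd u) = (f \<circ> chart_inv d) u"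
      if "u \<in> ?S" for u
      using nz[OF that] liouville_chart_inv[OF d that] by (simp add: f)
  qed
  then show ?thesis
    unfolding smooth_functions_def vf_scale_def using f by blast
qed

end

lemma vector_fields_diff:
  assumes M: "smooth_manifold T A"
    and X: "X \<in> vector_fields (slit_atlas A)" and Y: "Y \<in> vector_fields (slit_atlas A)"
  shows "(\<lambda>v d. X v d - Y v d) \<in> vector_fields (slit_atlas A)"
proof -
  have "smooth_on (snd d ` fst d) (\<lambda>u. X (chart_inv d u) d - Y (chart_inv d u) d)"
    if d: "d \<in> slit_atlas A" for d
  proof -
    note open_S = open_slit_chart[OF M d]
    have "smooth_on (snd d ` fst d) (\<lambda>u. X (chart_inv d u) d + (- 1) *\<^sub>R Y (chart_inv d u) d)"
      by (intro smooth_on_add[OF open_S] smooth_on_const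
          smooth_on_bounded_bilinear[OF open_S bounded_bilinear_scaleR])
        (use X Y d in \<open>simp_all add: vector_fields_def\<close>)
    then show ?thesis by simp
  qed
  moreover have "(\<lambda>d. X v d - Y v d) \<in> tangent_space (slit_atlas A) v"
    if "v \<in> carrier_of (slit_atlas A)" for v
    using tangent_space_lincomb[OF C1_slit_atlas[OF M], of "X v" v "Y v" 1 "- 1"] X Y that
    by (simp add: vector_fields_def)
  ultimately show ?thesis
    using X Y by (simp add: vector_fields_def)
qed


section \<open>Homogeneity of the fundamental tensor\<close>

text \<open>The inner derivative of the dilation contributes a factor \<open>t\<close>, so each
  derivative in \<open>y\<close> lowers the degree of homogeneity by one. The factor
  \<open>t\<close> is fixed and \<open>k\<close> is free, which lets the lemma be iterated.\<close>

lemma dy_homogeneous: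
  fixes f :: "('n::finite) xy \<Rightarrow> real"
  assumes S: "open S" "u \<in> S" and f: "\<And>u. u \<in> S \<Longrightarrow> f (fst u, t *\<^sub>R snd u) = k * f u"
    and diff: "f differentiable (at u)" "f differentiable (at (fst u, t *\<^sub>R snd u))"
  shows "t * dy j f (fst u, t *\<^sub>R snd u) = k * dy j f u"
proof -
  let ?D = "frechet_derivative f (at (fst u, t *\<^sub>R snd u))"
  have "((\<lambda>u. (fst u, t *\<^sub>R snd u)) has_derivative (\<lambda>w. (fst w, t *\<^sub>R snd w))) (at u)"
    by (auto intro!: derivative_eq_intros)
  then have "((\<lambda>u. f (fst u, t *\<^sub>R snd u)) has_derivative (\<lambda>w. ?D (fst w, t *\<^sub>R snd w))) (at u)"
    by (rule has_derivative_compose) (use diff(2) in \<open>simp flip: frechet_derivative_works\<close>)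
  then have "((\<lambda>u. k * f u) has_derivative (\<lambda>w. ?D (fst w, t *\<^sub>R snd w))) (at u)"
    by (rule has_derivative_transform_within_open[OF _ S f])
  moreover have "((\<lambda>u. k * f u) has_derivative (\<lambda>w. k * frechet_derivative f (at u) w)) (at u)"
    by (rule has_derivative_mult_right) (use diff(1) in \<open>simp flip: frechet_derivative_works\<close>)
  ultimately have "(\<lambda>w. ?D (fst w, t *\<^sub>R snd w)) = (\<lambda>w. k * frechet_derivative f (at u) w)"
    by (rule has_derivative_unique)
  from fun_cong[OF this, of "(0, axis j 1)"]
  have "?D (t *\<^sub>R (0, axis j 1)) = k * frechet_derivative f (at u) (0, axis j 1)"
    by simp
  then show ?thesis
    by (simp add: dy_def linear_cmul[OF linear_frechet_derivative[OF diff(2)]] del: scaleR_Pair)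
qed

text \<open>Two uses of \<open>dy_homogeneous\<close>, with \<open>k = t\<^sup>2\<close> and then
  \<open>k = t\<close>, bring the degree from 2 to 0; \<open>t > 0\<close> permits cancelling after
  each.\<close>

lemma fund_matrix_homogeneous:
  fixes L :: "('n::finite) xy \<Rightarrow> real"
  assumes S: "open S" "u \<in> S" and t: "t > 0" and smooth: "smooth_on S L"
    and cone: "\<And>u. u \<in> S \<Longrightarrow> (fst u, t *\<^sub>R snd u) \<in> S"
    and L: "\<And>u. u \<in> S \<Longrightarrow> L (fst u, t *\<^sub>R snd u) = t\<^sup>2 * L u"
  shows "fund_matrix L (fst u, t *\<^sub>R snd u) = fund_matrix L u"
proof -
  have diff: "L differentiable (at u)" "dy j L differentiable (at u)" if "u \<in> S" for u j
    using smooth_on_differentiable[OF smooth that]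
      smooth_on_differentiable[OF smooth_on_frechet_derivative[OF smooth] that]
    by (auto simp: dy_def[abs_def])
  have "t * dy j L (fst u, t *\<^sub>R snd u) = t\<^sup>2 * dy j L u" if "u \<in> S" for u j
    by (rule dy_homogeneous[where f = L, OF S(1) that L]) (use diff that cone in auto)
  then have "dy j L (fst u, t *\<^sub>R snd u) = t * dy j L u" if "u \<in> S" for u j
    using t that by (simp add: power2_eq_square)
  then have "t * dy i (dy j L) (fst u, t *\<^sub>R snd u) = t * dy i (dy j L) u" for i j
    by (intro dy_homogeneous[OF S]) (use diff S cone in auto)
  then show ?thesis
    using t by (simp add: fund_matrix_def vec_eq_iff)
qed


section \<open>The orthogonal complement of the Liouville field\<close>

text \<open>For vertical \<open>w\<close> the horizontal summand and the connection term in
  \<open>vert_part\<close> both vanish. The spray coefficients thus drop out, and only the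
  fundamental matrix remains in the orthogonality condition.\<close>

lemma sasaki_liouville:
  assumes "w \<in> vertical A v" "v \<in> slit_tangent_bundle A"
  defines "d \<equiv> chart_at (slit_atlas A) v"
  shows "sasaki A F v w (liouville A v) =
    snd (w d) \<bullet> (fund_matrix (F_sq F d) (snd d v) *v snd (snd d v))"
proof -
  have "fst (w d) = 0"
    using assms slit_chart_at[OF assms(2)] by (auto simp: vertical_def)
  then show ?thesis
    using slit_chart_at[OF assms(2)] unfolding sasaki_def d_def[symmetric]
    by (simp add: sasaki_coord_def vert_part_def liouville_def)
qed

context
  fixes T :: "'m topology" and A :: "('m, real ^ 'n::finite) chart set"
    and F :: "('m, real ^ 'n) tpoint \<Rightarrow> real"
  assumes finsler: "finsler_manifold T A F"
begin

lemma finsler_smooth_manifold: "smooth_manifold T A"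
  using finsler by (simp add: finsler_manifold_def)

lemma finsler_smooth: "F \<in> smooth_functions (slit_atlas A)"
  using finsler unfolding finsler_manifold_def by (elim conjE)

lemma fund_matrix_pos_def:
  "d \<in> slit_atlas A \<Longrightarrow> v \<in> fst d \<Longrightarrow> b \<noteq> 0 \<Longrightarrow> 0 < b \<bullet> (fund_matrix (F_sq F d) (snd d v) *v b)"
  using finsler unfolding finsler_manifold_def by blast

lemma finsler_homogeneous:
  assumes "(p, \<xi>) \<in> tangent_bundle A" "t > 0"
  shows "F (p, \<lambda>c. t *\<^sub>R \<xi> c) = t * F (p, \<xi>)"
proof -
  have "\<forall>(p, \<xi>)\<in>tangent_bundle A. \<forall>t>0. F (p, \<lambda>c. t *\<^sub>R \<xi> c) = t * F (p, \<xi>)"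
    using finsler unfolding finsler_manifold_def by (elim conjE)
  from bspec[OF this assms(1)] assms(2) show ?thesis
    by (simp only: prod.case)
qed

lemma slit_dilation:
  assumes "(p, \<xi>) \<in> fst (induced_chart A c)" "t > 0"
  shows "(p, \<lambda>c. t *\<^sub>R \<xi> c) \<in> fst (induced_chart A c)"
    and "snd (induced_chart A c) (p, \<lambda>c. t *\<^sub>R \<xi> c) =
      (fst (snd (induced_chart A c) (p, \<xi>)), t *\<^sub>R snd (snd (induced_chart A c) (p, \<xi>)))"
    and "F (p, \<lambda>c. t *\<^sub>R \<xi> c) = t * F (p, \<xi>)"
proof -
  have "(p, \<xi>) \<in> tangent_bundle A"
    using assms(1) by (simp add: fst_induced_chart slit_tangent_bundle_def)
  then show "F (p, \<lambda>c. t *\<^sub>R \<xi> c) = t * F (p, \<xi>)"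
    using assms(2) by (rule finsler_homogeneous)
  show "(p, \<lambda>c. t *\<^sub>R \<xi> c) \<in> fst (induced_chart A c)"
  proof -
    have \<xi>: "\<xi> \<in> tangent_space A p" "\<xi> \<noteq> (\<lambda>_. 0)" "p \<in> carrier_of A" "p \<in> fst c"
      using assms(1) by (simp_all add: fst_induced_chart slit_tangent_bundle_iff)
    then obtain e where "\<xi> e \<noteq> 0" by blast
    then have "(\<lambda>c. t *\<^sub>R \<xi> c) \<noteq> (\<lambda>_. 0)"
      using assms(2) by (auto dest: fun_cong[of _ _ e])
    then show ?thesis
      using \<xi> tangent_space_scale[OF smooth_manifold_C1_atlas[OF finsler_smooth_manifold] \<xi>(1), of t]
      by (simp add: fst_induced_chart slit_tangent_bundle_iff)
  qed
qed (simp add: snd_induced_chart)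

text \<open>Whether an induced chart contains a point of the slit bundle depends on the base point
  alone, so the choice operator faces the same predicate over the whole fibre.\<close>

lemma slit_chart_at_dilation:
  assumes "(p, \<xi>) \<in> slit_tangent_bundle A" "(p, \<zeta>) \<in> slit_tangent_bundle A"
  shows "chart_at (slit_atlas A) (p, \<zeta>) = chart_at (slit_atlas A) (p, \<xi>)"
proof -
  have "d \<in> slit_atlas A \<and> (p, \<zeta>) \<in> fst d \<longleftrightarrow> d \<in> slit_atlas A \<and> (p, \<xi>) \<in> fst d" for d
    using assms by (auto simp: slit_atlas_def fst_induced_chart)
  then show ?thesis by (simp add: chart_at_def)
qed

lemma fund_matrix_slit_dilation:
  assumes d: "d \<in> slit_atlas A" and u: "u \<in> snd d ` fst d" and t: "t > 0"
  shows "fund_matrix (F_sq F d) (fst u, t *\<^sub>R snd u) = fund_matrix (F_sq F d) u"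
proof (rule fund_matrix_homogeneous[OF open_slit_chart[OF finsler_smooth_manifold d] u t])
  have "smooth_on (snd d ` fst d) (\<lambda>u. (F \<circ> chart_inv d) u * (F \<circ> chart_inv d) u)"
    by (rule smooth_on_bounded_bilinear[OF open_slit_chart[OF finsler_smooth_manifold d]
          bounded_bilinear_mult]) (use finsler_smooth d in \<open>simp_all add: smooth_functions_def o_def\<close>)
  then show "smooth_on (snd d ` fst d) (F_sq F d)"
    by (simp add: F_sq_def power2_eq_square)
next
  fix u assume "u \<in> snd d ` fst d"
  then obtain p \<xi> where p: "(p, \<xi>) \<in> fst d" and u: "u = snd d (p, \<xi>)" by auto
  obtain c where c: "d = induced_chart A c" using d by (auto simp: slit_atlas_def)
  let ?v = "(p, \<lambda>c. t *\<^sub>R \<xi> c)"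
  have v: "?v \<in> fst d" "snd d ?v = (fst u, t *\<^sub>R snd u)" "F ?v = t * F (p, \<xi>)"
    using slit_dilation[of p \<xi> c t] p t unfolding c u by auto
  show "(fst u, t *\<^sub>R snd u) \<in> snd d ` fst d"
    using imageI[OF v(1), of "snd d"] unfolding v(2) .
  have "chart_inv d (fst u, t *\<^sub>R snd u) = ?v" "chart_inv d u = (p, \<xi>)"
    using slit_chart_inv[OF finsler_smooth_manifold d v(1)]
      slit_chart_inv[OF finsler_smooth_manifold d p]
    unfolding v(2) u[symmetric] .
  then show "F_sq F d (fst u, t *\<^sub>R snd u) = t\<^sup>2 * F_sq F d u"
    by (simp only: F_sq_def v(3) power_mult_distrib)
qed

text \<open>The fundamental tensor is constant along the rays \<open>t \<mapsto> (x, t y)\<close>, so orthogonality to the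
  Liouville field on a ray is one fixed linear condition, and it survives differentiation.\<close>

lemma lie_bracket_liouville_perp:
  assumes Z: "Z \<in> sections (slit_atlas A) (liouville_perp A F)" and v: "v \<in> slit_tangent_bundle A"
  shows "lie_bracket (slit_atlas A) (liouville A) Z v \<in> liouville_perp A F v"
proof -
  note M = finsler_smooth_manifold
  let ?W = "lie_bracket (slit_atlas A) (liouville A) Z v"
  define d where "d = chart_at (slit_atlas A) v"
  have d: "d \<in> slit_atlas A" "v \<in> fst d"
    using slit_chart_at[OF v] by (auto simp: d_def)
  obtain c where c: "d = induced_chart A c" using d by (auto simp: slit_atlas_def)
  obtain p \<xi> where v_eq: "v = (p, \<xi>)" by (cases v)
  define x where "x = fst (snd d v)"
  define y where "y = snd (snd d v)"
  have xy: "snd d v = (x, y)" by (simp add: x_def y_def)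
  \<comment> \<open>The functional \<open>g(\<cdot>, \<Gamma>)\<close> at \<open>v\<close>. At the
    dilated point it is only multiplied by the dilation factor, so its kernel is the same along the
    ray.\<close>
  define \<eta> where "\<eta> = fund_matrix (F_sq F d) (snd d v) *v y"
  define Zd where "Zd = (\<lambda>u. Z (chart_inv d u) d)"
  have Z_vert: "Z \<in> sections (slit_atlas A) (vertical A)"
    using Z by (auto simp: sections_def liouville_perp_def)
  have perp: "snd (Z q (chart_at (slit_atlas A) q)) \<bullet>
      (fund_matrix (F_sq F (chart_at (slit_atlas A) q)) (snd (chart_at (slit_atlas A) q) q)
        *v snd (snd (chart_at (slit_atlas A) q) q)) = 0"
    if "q \<in> slit_tangent_bundle A" for q
    using Z that sasaki_liouville[of "Z q" A q F]
    by (auto simp: sections_def liouville_perp_def carrier_of_slit_atlas)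
  \<comment> \<open>Moving by \<open>s\<close> in direction \<open>(0, y)\<close> is the dilation by
    \<open>1 + s\<close>, which the bound keeps positive.\<close>
  have ray: "snd (Zd (snd d v + s *\<^sub>R (0, y))) \<bullet> \<eta> = 0" if s: "s > - 1" for s
  proof -
    let ?q = "(p, \<lambda>c. (1 + s) *\<^sub>R \<xi> c)"
    have q: "?q \<in> fst d" "snd d ?q = (x, (1 + s) *\<^sub>R y)"
      using slit_dilation[of p \<xi> c "1 + s"] d(2) s unfolding c v_eq x_def y_def by auto
    have q_slit: "?q \<in> slit_tangent_bundle A"
      using q(1) by (simp add: c fst_induced_chart)
    have chart_q: "chart_at (slit_atlas A) ?q = d"
      using slit_chart_at_dilation[OF v[unfolded v_eq] q_slit] by (simp add: d_def v_eq)
    have "fund_matrix (F_sq F d) (snd d ?q) = fund_matrix (F_sq F d) (snd d v)"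
      using fund_matrix_slit_dilation[OF d(1) imageI[OF d(2)], of "1 + s"] s q(2) xy by simp
    with perp[OF q_slit] s q(2) have "snd (Z ?q d) \<bullet> \<eta> = 0"
      by (simp add: chart_q \<eta>_def matrix_vector_mult_scaleR)
    moreover have "snd d v + s *\<^sub>R (0, y) = snd d ?q"
      unfolding q(2) xy by (simp add: scaleR_add_left)
    ultimately show ?thesis
      by (simp only: Zd_def slit_chart_inv[OF M d(1) q(1)])
  qed
  have "((\<lambda>s. Zd (snd d v + s *\<^sub>R (0, y))) has_vector_derivative
      frechet_derivative Zd (at (snd d v)) (0, y)) (at 0)"
    unfolding Zd_def by (intro frechet_derivative_along_line section_differentiable[OF M Z d])
  moreover have "bounded_linear (\<lambda>w::'n xy. snd w \<bullet> \<eta>)"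
    by (intro bounded_linear_compose[OF bounded_linear_inner_left bounded_linear_snd])
  ultimately have deriv: "((\<lambda>s. snd (Zd (snd d v + s *\<^sub>R (0, y))) \<bullet> \<eta>) has_vector_derivative
      snd (frechet_derivative Zd (at (snd d v)) (0, y)) \<bullet> \<eta>) (at 0)"
    by (rule bounded_linear.has_vector_derivative[rotated])
  have eventually_0: "\<forall>\<^sub>F s in at (0::real). snd (Zd (snd d v + s *\<^sub>R (0, y))) \<bullet> \<eta> = 0"
  proof (rule eventually_mono)
    show "\<forall>\<^sub>F s in at (0::real). s \<in> {- 1<..}"
      by (rule eventually_at_in_open') auto
    show "snd (Zd (snd d v + s *\<^sub>R (0, y))) \<bullet> \<eta> = 0" if "s \<in> {- 1<..}" for s
      by (rule ray) (use that in simp)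
  qed
  have "snd (frechet_derivative Zd (at (snd d v)) (0, y)) \<bullet> \<eta> = 0"
    by (rule has_vector_derivative_unique_eventually[OF eventually_0 ray deriv
          has_vector_derivative_const]) simp
  moreover have "snd (Z v d) \<bullet> \<eta> = 0"
    using ray[of 0] by (simp add: Zd_def slit_chart_inv[OF M d] flip: zero_prod_def)
  ultimately have "snd (?W d) \<bullet> \<eta> = 0"
    by (simp add: lie_bracket_liouville[OF M d] inner_diff_left flip: Zd_def y_def)
  moreover have "?W \<in> vertical A v"
    by (rule lie_bracket_vertical[OF M liouville_section_vertical[OF M] Z_vert v])
  ultimately show ?thesis
    using sasaki_liouville[of ?W A v F] v by (simp add: liouville_perp_def \<eta>_def y_def d_def)
qed

section \<open>Splitting of the vertical bundle and the projection\<close>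

text \<open>Pairing with \<eta> kills the complement and gives
  \<open>g(\<Gamma>, \<Gamma>) > 0\<close> on \<Gamma>, so the coefficient of \<Gamma> is
  determined.\<close>

lemma liouville_decomposition_unique:
  assumes v: "v \<in> slit_tangent_bundle A"
    and z: "z \<in> liouville_perp A F v" "z' \<in> liouville_perp A F v"
    and l: "l \<in> liouville_line A v" "l' \<in> liouville_line A v"
    and eq: "(\<lambda>d. z d + l d) = (\<lambda>d. z' d + l' d)"
  shows "z = z'"
proof -
  note M = finsler_smooth_manifold
  define d where "d = chart_at (slit_atlas A) v"
  have d: "d \<in> slit_atlas A" "v \<in> fst d"
    using slit_chart_at[OF v] by (auto simp: d_def)
  define y where "y = snd (snd d v)"
  define \<eta> where "\<eta> = fund_matrix (F_sq F d) (snd d v) *v y"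
  obtain t t' where t: "l = (\<lambda>d. t *\<^sub>R liouville A v d)" "l' = (\<lambda>d. t' *\<^sub>R liouville A v d)"
    using l by (auto simp: liouville_line_def)
  have "snd (z d) \<bullet> \<eta> = 0" "snd (z' d) \<bullet> \<eta> = 0"
    using z sasaki_liouville[of z A v F] sasaki_liouville[of z' A v F] v
    by (auto simp: liouville_perp_def \<eta>_def y_def d_def)
  moreover have "snd (z d) + t *\<^sub>R y = snd (z' d) + t' *\<^sub>R y"
    using arg_cong[OF fun_cong[OF eq, of d], of snd] d by (simp add: t liouville_def y_def)
  then have "snd (z d) \<bullet> \<eta> + t * (y \<bullet> \<eta>) = snd (z' d) \<bullet> \<eta> + t' * (y \<bullet> \<eta>)"
    unfolding inner_add_left[symmetric] inner_scaleR_left[symmetric] by (rule arg_cong)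
  moreover have "0 < y \<bullet> \<eta>"
    unfolding \<eta>_def y_def by (rule fund_matrix_pos_def[OF d liouville_nonzero[OF M d]])
  ultimately have "t = t'" by simp
  then have "z d = z' d" for d
    using fun_cong[OF eq, of d] by (simp add: t)
  then show ?thesis by blast
qed

lemma liouville_decomposition_exists:
  assumes v: "v \<in> slit_tangent_bundle A" and w: "w \<in> vertical A v"
  shows "\<exists>z\<in>liouville_perp A F v. \<exists>l\<in>liouville_line A v. w = (\<lambda>d. z d + l d)"
proof -
  note M = finsler_smooth_manifold
  define d where "d = chart_at (slit_atlas A) v"
  have d: "d \<in> slit_atlas A" "v \<in> fst d"
    using slit_chart_at[OF v] by (auto simp: d_def)
  define y where "y = snd (snd d v)"
  define \<eta> where "\<eta> = fund_matrix (F_sq F d) (snd d v) *v y"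
  have pos: "0 < y \<bullet> \<eta>"
    unfolding \<eta>_def y_def by (rule fund_matrix_pos_def[OF d liouville_nonzero[OF M d]])
  \<comment> \<open>The Gram-Schmidt coefficient
    \<open>g(w, \<Gamma>) / g(\<Gamma>, \<Gamma>)\<close>.\<close>
  define t where "t = (snd (w d) \<bullet> \<eta>) / (y \<bullet> \<eta>)"
  define z where "z = (\<lambda>d. w d - t *\<^sub>R liouville A v d)"
  have z_vert: "z \<in> vertical A v"
    using vertical_lincomb[OF M w liouville_vertical[OF M], of 1 "- t"] by (simp add: z_def)
  have "snd (z d) \<bullet> \<eta> = 0"
    using d pos by (simp add: z_def liouville_def inner_diff_left t_def flip: y_def)
  then have "z \<in> liouville_perp A F v"
    using sasaki_liouville[OF z_vert v, of F] z_vert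
    by (simp add: liouville_perp_def \<eta>_def y_def d_def)
  moreover have "w = (\<lambda>d. z d + t *\<^sub>R liouville A v d)"
    by (simp add: z_def)
  moreover have "(\<lambda>d. t *\<^sub>R liouville A v d) \<in> liouville_line A v"
    by (auto simp: liouville_line_def)
  ultimately show ?thesis
    by (intro bexI[of _ z] bexI[of _ "\<lambda>d. t *\<^sub>R liouville A v d"])
qed

lemma proj_perp_eqI:
  assumes "v \<in> slit_tangent_bundle A" "z \<in> liouville_perp A F v" "l \<in> liouville_line A v"
    and "W v = (\<lambda>d. z d + l d)"
  shows "proj_perp A F W v = z"
proof -
  have "(THE z. z \<in> liouville_perp A F v \<and> (\<exists>l\<in>liouville_line A v. W v = (\<lambda>d. z d + l d))) = z"
  proof (rule the_equality)
    fix z' assume "z' \<in> liouville_perp A F v \<and> (\<exists>l\<in>liouville_line A v. W v = (\<lambda>d. z' d + l d))"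
    then obtain l' where z': "z' \<in> liouville_perp A F v" "l' \<in> liouville_line A v"
      and eq: "W v = (\<lambda>d. z' d + l' d)"
      by blast
    show "z' = z"
      using liouville_decomposition_unique[OF assms(1) z'(1) assms(2) z'(2) assms(3)]
      unfolding eq[symmetric] assms(4)[symmetric] by blast
  qed (use assms in blast)
  then show ?thesis
    using assms(1) by (simp add: proj_perp_def)
qed

lemma proj_perp_decomposition:
  assumes v: "v \<in> slit_tangent_bundle A" and W: "W v \<in> vertical A v"
  shows "\<exists>l\<in>liouville_line A v. W v = (\<lambda>d. proj_perp A F W v d + l d)"
proof -
  obtain z l where zl: "z \<in> liouville_perp A F v" "l \<in> liouville_line A v" "W v = (\<lambda>d. z d + l d)"
    using liouville_decomposition_exists[OF v W] by blast
  have "proj_perp A F W v = z"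
    by (rule proj_perp_eqI[where W = W, OF v zl])
  with zl show ?thesis by blast
qed

lemma zero_in_liouville_line: "(\<lambda>_. 0) \<in> liouville_line A v"
  unfolding liouville_line_def by (auto intro: exI[of _ 0])

text \<open>Fields are compared on the whole ambient type, hence the hypothesis off the slit bundle.
  The pointwise form serves both sections and the bracket with \<Gamma>.\<close>

lemma proj_perp_id:
  assumes "\<And>v. v \<in> slit_tangent_bundle A \<Longrightarrow> Z v \<in> liouville_perp A F v"
    and "\<And>v. v \<notin> slit_tangent_bundle A \<Longrightarrow> Z v = (\<lambda>_. 0)"
  shows "proj_perp A F Z = Z"
proof
  fix v show "proj_perp A F Z v = Z v"
  proof (cases "v \<in> slit_tangent_bundle A")
    case True
    then show ?thesis
      using proj_perp_eqI[where W=Z, OF True assms(1)[OF True] zero_in_liouville_line] by simp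
  next
    case False
    then show ?thesis using assms(2) by (simp add: proj_perp_def)
  qed
qed

lemma lie_bracket_outside:
  assumes "v \<notin> slit_tangent_bundle A"
  shows "lie_bracket (slit_atlas A) X Y v = (\<lambda>_. 0)"
proof -
  have "\<not> (d \<in> slit_atlas A \<and> v \<in> fst d)" for d
    using assms unfolding carrier_of_slit_atlas[symmetric] carrier_of_def by blast
  then show ?thesis by (simp add: lie_bracket_def cong: conj_cong)
qed

text \<open>\<open>[f\<Gamma>, Z + h\<Gamma>] = f[\<Gamma>, Z] + (f\<Gamma>(h) - Z(f) - h\<Gamma>(f))\<Gamma>\<close>. Since \<open>[f\<Gamma>, Z + h\<Gamma>] - f[\<Gamma>, Z]\<close> is already
  known to be a tangent vector, its proportionality to \<open>\<Gamma>\<close> need only be checked in a single chart.\<close>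

lemma proj_perp_bracket:
  assumes f: "f \<in> smooth_functions (slit_atlas A)"
    and X: "vf_scale f (liouville A) \<in> sections (slit_atlas A) (liouville_line A)"
    and Z: "Z \<in> sections (slit_atlas A) (liouville_perp A F)"
    and Z': "Z' \<in> sections (slit_atlas A) (vertical A)" "proj_perp A F Z' = Z"
  shows "proj_perp A F (lie_bracket (slit_atlas A) (vf_scale f (liouville A)) Z') =
    vf_scale f (lie_bracket (slit_atlas A) (liouville A) Z)"
proof
  note M = finsler_smooth_manifold
  let ?\<Gamma> = "liouville A" and ?B = "slit_atlas A"
  fix v
  show "proj_perp A F (lie_bracket ?B (vf_scale f ?\<Gamma>) Z') v = vf_scale f (lie_bracket ?B ?\<Gamma> Z) v"
  proof (cases "v \<in> slit_tangent_bundle A")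
    case False
    then show ?thesis
      by (simp add: proj_perp_def vf_scale_def lie_bracket_outside)
  next
    case v: True
    have Z_vert: "Z \<in> sections ?B (vertical A)"
      using Z by (auto simp: sections_def liouville_perp_def)
    have X_vert: "vf_scale f ?\<Gamma> \<in> sections ?B (vertical A)"
      using X liouville_line_vertical[OF M] by (auto simp: sections_def)
    \<comment> \<open>The condition on the projection makes \<open>Z' - Z\<close> a multiple of
      \<Gamma> at each point; as a smooth field it then has a smooth coefficient
      \<open>h\<close>.\<close>
    have "(\<lambda>v d. Z' v d - Z v d) \<in> sections ?B (liouville_line A)"
      unfolding sections_def
    proof (intro CollectI conjI ballI)
      show "(\<lambda>v d. Z' v d - Z v d) \<in> vector_fields ?B"
        using Z Z' by (intro vector_fields_diff[OF M]) (auto simp: sections_def)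
      fix q assume "q \<in> carrier_of ?B"
      then have "q \<in> slit_tangent_bundle A" "Z' q \<in> vertical A q"
        using Z' by (auto simp: sections_def carrier_of_slit_atlas)
      from proj_perp_decomposition[where W=Z', OF this] obtain l
        where l: "l \<in> liouville_line A q" "Z' q = (\<lambda>d. Z q d + l d)"
        unfolding Z'(2) by blast
      then have "(\<lambda>d. Z' q d - Z q d) = l" by (simp add: fun_eq_iff)
      with l(1) show "(\<lambda>d. Z' q d - Z q d) \<in> liouville_line A q" by simp
    qed
    from liouville_line_section[OF M this] obtain h
      where h: "h \<in> smooth_functions ?B" and h_eq: "(\<lambda>v d. Z' v d - Z v d) = vf_scale h ?\<Gamma>"
      by blast
    have Z'_eq: "Z' v d = Z v d + h v *\<^sub>R ?\<Gamma> v d" for v d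
      using fun_cong[OF fun_cong[OF h_eq], of v d] by (simp add: vf_scale_def algebra_simps)
    let ?W = "lie_bracket ?B (vf_scale f ?\<Gamma>) Z' v"
    let ?N = "\<lambda>d. f v *\<^sub>R lie_bracket ?B ?\<Gamma> Z v d"
    have W_vert: "?W \<in> vertical A v"
      by (rule lie_bracket_vertical[OF M X_vert Z'(1) v])
    have bracket_perp: "lie_bracket ?B ?\<Gamma> Z v \<in> liouville_perp A F v"
      by (rule lie_bracket_liouville_perp[OF Z v])
    then have N_vert: "?N \<in> vertical A v"
      using vertical_lincomb[OF M, of _ v _ "f v" 0] by (fastforce simp: liouville_perp_def)
    have N_perp: "?N \<in> liouville_perp A F v"
      using bracket_perp N_vert sasaki_liouville[OF N_vert v, of F]
        sasaki_liouville[OF _ v, of "lie_bracket ?B ?\<Gamma> Z v" F]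
      by (simp add: liouville_perp_def)
    define d where "d = chart_at ?B v"
    have d: "d \<in> ?B" "v \<in> fst d"
      using slit_chart_at[OF v] by (auto simp: d_def)
    define u where "u = snd d v"
    define y where "y = snd u"
    have u: "u \<in> snd d ` fst d" and inv_u: "chart_inv d u = v"
      using d slit_chart_inv[OF M d] by (auto simp: u_def)
    define Df where "Df = frechet_derivative (f \<circ> chart_inv d) (at u)"
    define Dh where "Dh = frechet_derivative (h \<circ> chart_inv d) (at u)"
    define DZ where "DZ = frechet_derivative (\<lambda>u. Z (chart_inv d u) d) (at u)"
    have Df: "((f \<circ> chart_inv d) has_derivative Df) (at u)"
      and Dh: "((h \<circ> chart_inv d) has_derivative Dh) (at u)"
      and DZ: "((\<lambda>u. Z (chart_inv d u) d) has_derivative DZ) (at u)"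
      unfolding Df_def Dh_def DZ_def frechet_derivative_works[symmetric]
      using smooth_on_differentiable[OF _ u] f h d(1) section_differentiable[OF M Z d]
      by (auto simp: smooth_functions_def u_def)
    have D\<Gamma>: "((\<lambda>u. (0::real^'n, snd u)) has_derivative (\<lambda>w. (0, snd w))) (at u)"
      by (intro has_derivative_Pair has_derivative_const has_derivative_snd has_derivative_ident)
    note transform = has_derivative_transform_within_open[OF _ open_slit_chart[OF M d(1)] u]
    have "((\<lambda>u. vf_scale f ?\<Gamma> (chart_inv d u) d) has_derivative
        (\<lambda>w. f v *\<^sub>R (0, snd w) + Df w *\<^sub>R (0, y))) (at u)"
      by (rule transform[OF has_derivative_scaleR[OF Df D\<Gamma>, unfolded o_apply inv_u y_def[symmetric]]])
        (simp add: vf_scale_def liouville_chart_inv[OF M d(1)])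
    note X_deriv = fun_cong[OF frechet_derivative_at[OF this], symmetric]
    have "((\<lambda>u. Z' (chart_inv d u) d) has_derivative
        (\<lambda>w. DZ w + (h v *\<^sub>R (0, snd w) + Dh w *\<^sub>R (0, y)))) (at u)"
      by (rule transform[OF has_derivative_add[OF DZ
              has_derivative_scaleR[OF Dh D\<Gamma>, unfolded o_apply inv_u y_def[symmetric]]]])
        (simp add: Z'_eq liouville_chart_inv[OF M d(1)])
    note Z'_deriv = fun_cong[OF frechet_derivative_at[OF this], symmetric]
    have \<Gamma>: "?\<Gamma> v d = (0, y)"
      using d by (simp add: liouville_def y_def u_def)
    have linear: "linear DZ" "linear Dh"
      using DZ Dh has_derivative_linear by auto
    \<comment> \<open>The coefficient of \<Gamma> in the formula above, with
      \<open>Z(f) + h\<Gamma>(f)\<close> collected into \<open>Z'(f)\<close>.\<close>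
    define r where "r = f v * Dh (0, y) - Df (Z' v d)"
    have "fst (Z v d) = 0"
      using Z_vert d v by (auto simp: sections_def vertical_def carrier_of_slit_atlas)
    then have snd_Z': "snd (Z' v d) = snd (Z v d) + h v *\<^sub>R y"
      by (simp add: Z'_eq \<Gamma>)
    have "vf_scale f ?\<Gamma> v d = f v *\<^sub>R (0, y)"
      by (simp add: vf_scale_def \<Gamma>)
    with d have W_d: "?W d = DZ (f v *\<^sub>R (0, y)) + (h v *\<^sub>R (0, snd (f v *\<^sub>R (0::real^'n, y)))
        + Dh (f v *\<^sub>R (0, y)) *\<^sub>R (0, y)) - (f v *\<^sub>R (0, snd (Z' v d)) + Df (Z' v d) *\<^sub>R (0, y))"
      by (simp only: lie_bracket_def if_True simp_thms X_deriv Z'_deriv flip: u_def)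
    have N_d: "lie_bracket ?B ?\<Gamma> Z v d = DZ (0, y) - (0, snd (Z v d))"
      unfolding lie_bracket_liouville[OF M d] DZ_def y_def u_def ..
    \<comment> \<open>The two terms \<open>f h y\<close> cancel, which is
      \<open>[\<Gamma>, \<Gamma>] = 0\<close> in coordinates.\<close>
    have chart_eq: "?W d - ?N d = r *\<^sub>R ?\<Gamma> v d"
      unfolding W_d N_d \<Gamma> r_def linear_cmul[OF linear(1)] linear_cmul[OF linear(2)]
      by (simp add: snd_Z' prod_eq_iff algebra_simps)
    have "(\<lambda>d. ?W d - ?N d) = (\<lambda>d. r *\<^sub>R ?\<Gamma> v d)"
    proof (rule tangent_space_eqI[OF _ _ d])
      show "?W d - ?N d = r *\<^sub>R ?\<Gamma> v d" by (rule chart_eq)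
      show "(\<lambda>d. ?W d - ?N d) \<in> tangent_space ?B v"
        using vertical_lincomb[OF M W_vert N_vert, of 1 "- 1"] by (simp add: vertical_def)
      show "(\<lambda>d. r *\<^sub>R ?\<Gamma> v d) \<in> tangent_space ?B v"
        using liouville_vertical[OF M, of v]
        by (intro tangent_space_scale C1_slit_atlas[OF M]) (simp add: vertical_def)
    qed
    then have "?W = (\<lambda>d. ?N d + r *\<^sub>R ?\<Gamma> v d)"
      by (simp add: fun_eq_iff algebra_simps)
    moreover have "(\<lambda>d. r *\<^sub>R ?\<Gamma> v d) \<in> liouville_line A v"
      by (auto simp: liouville_line_def)
    ultimately show ?thesis
      using proj_perp_eqI[OF v N_perp] by (simp add: vf_scale_def)
  qed
qed

end

theorem proposition3p1:
  fixes T :: "'m topology"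
    and A :: "('m, real ^ 'n::finite) chart set"
    and F :: "('m, real ^ 'n) tpoint \<Rightarrow> real"
    and nabla :: "(('m, real ^ 'n) tpoint, 'n xy) vfield
      \<Rightarrow> (('m, real ^ 'n) tpoint, 'n xy) vfield
      \<Rightarrow> (('m, real ^ 'n) tpoint, 'n xy) vfield"
  assumes "finsler_manifold T A F"
    and "bundle_connection (slit_atlas A) (liouville_perp A F) nabla"
  shows "basic_connection A F nabla \<longleftrightarrow>
    (\<forall>Z \<in> sections (slit_atlas A) (liouville_perp A F).
       nabla (liouville A) Z = lie_bracket (slit_atlas A) (liouville A) Z)"
proof
  note M = finsler_smooth_manifold[OF assms(1)]
  assume basic: "basic_connection A F nabla"
  show "\<forall>Z \<in> sections (slit_atlas A) (liouville_perp A F).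
      nabla (liouville A) Z = lie_bracket (slit_atlas A) (liouville A) Z"
  proof
    fix Z assume Z: "Z \<in> sections (slit_atlas A) (liouville_perp A F)"
    have "proj_perp A F Z = Z"
      using Z by (intro proj_perp_id[OF assms(1)])
        (auto simp: sections_def vector_fields_def carrier_of_slit_atlas)
    moreover have "Z \<in> sections (slit_atlas A) (vertical A)"
      using Z by (auto simp: sections_def liouville_perp_def)
    ultimately have "nabla (liouville A) Z = proj_perp A F (lie_bracket (slit_atlas A) (liouville A) Z)"
      using basic Z liouville_section_line[OF M] unfolding basic_connection_def by blast
    also have "\<dots> = lie_bracket (slit_atlas A) (liouville A) Z"
      by (intro proj_perp_id[OF assms(1)] lie_bracket_liouville_perp[OF assms(1) Z]
          lie_bracket_outside[OF assms(1)])
    finally show "nabla (liouville A) Z = lie_bracket (slit_atlas A) (liouville A) Z" .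
  qed
next
  note M = finsler_smooth_manifold[OF assms(1)]
  assume bracket: "\<forall>Z \<in> sections (slit_atlas A) (liouville_perp A F).
      nabla (liouville A) Z = lie_bracket (slit_atlas A) (liouville A) Z"
  show "basic_connection A F nabla"
    unfolding basic_connection_def
  proof (intro ballI impI)
    fix X Z Z'
    assume X: "X \<in> sections (slit_atlas A) (liouville_line A)"
      and Z: "Z \<in> sections (slit_atlas A) (liouville_perp A F)"
      and Z': "Z' \<in> sections (slit_atlas A) (vertical A)" "proj_perp A F Z' = Z"
    obtain f where f: "f \<in> smooth_functions (slit_atlas A)" "X = vf_scale f (liouville A)"
      using liouville_line_section[OF M X] by blast
    \<comment> \<open>Tensoriality of the connection in its first argument; it matches the factor
      \<open>f\<close> that survives the projection of the bracket.\<close>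
    have "nabla X Z = vf_scale f (nabla (liouville A) Z)"
      using assms(2) f Z liouville_vector_field[OF M] unfolding bundle_connection_def by blast
    also have "\<dots> = proj_perp A F (lie_bracket (slit_atlas A) X Z')"
      using proj_perp_bracket[OF assms(1) f(1) X[unfolded f(2)] Z Z'] bracket Z f(2) by simp
    finally show "nabla X Z = proj_perp A F (lie_bracket (slit_atlas A) X Z')" .
  qed
qed

end
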